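(* Let $\alpha$ be an irrational real number. Let $V=\begin{pmatrix}a&b\\c&d\end{pmatrix}\in\mathrm{SL}_2(\mathbb Z)$ with $c>0$, put $V\alpha:=\dfrac{a\alpha+b}{c\alpha+d}$, and suppose that $\eta:=c\alpha+d>0$. Let $m\ge 2$ be an integer. For $k\in\mathbb N$ put $K=\lfloor k/\eta\rfloor$, and for each $j$ modulo $c$ put $x_j=1-\left\{\frac{dj}{c}\right\}$ and $y_j=\left\{\frac{j}{c}\right\}$. Then $$ \xi_K(2m-1,\alpha)-\eta^{2m-2}\,\xi_k(2m-1,V\alpha)+\frac{\eta^{2m-2}}{\pi k^{2m-1}}\cdot\frac{1}{1-\left\{\frac{K-ak}{c}\right\}-c^{-1}\left\{\frac{k}{\eta}\right\}} $$ $$ =(-1)^{m-1}(2\pi)^{2m-1}\sum_{\ell=0}^{2m}\ \sum_{j\,\mathrm{mod}\,c}\frac{B_\ell(x_j)\,B_{2m-\ell}(y_j)}{\ell!\,(2m-\ell)!}\,\eta^{2m-\ell-1}+O(k^{-1}) $$ as $k\to\infty$ through the positive integers, where the implied constant may depend on $\alpha$, $V$ and $m$ but not on $k$.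
   Context: $\mathbb N$ denotes the set of positive integers. For $x\in\mathbb R$, $\lfloor x\rfloor$ is the greatest integer less than or equal to $x$ and $\{x\}=x-\lfloor x\rfloor$ is the fractional part. For an irrational real number $\beta$ and $k,m\in\mathbb N$, the finite cotangent Dirichlet series is $$\xi_k(2m-1,\beta):=\sum_{n=1}^k\frac{\cot(\pi n\beta)}{n^{2m-1}}.$$ The Bernoulli polynomials $B_n(x)$ are defined by $\dfrac{te^{tx}}{e^t-1}=\sum_{n=0}^\infty\dfrac{B_n(x)}{n!}t^n$; in particular $B_0(x)=1$. The sum over $j\,\mathrm{mod}\,c$ runs over a complete set of residues modulo $c$ (the values $x_j,y_j$ depend only on $j$ modulo $c$). *)

theory Defs
  imports
    "HOL-Analysis.Analysis"
    "HOL-Computational_Algebra.Formal_Power_Series"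
    "HOL-Library.Landau_Symbols"
begin

text \<open>The finite cotangent Dirichlet series \<open>\<xi>\<^sub>k(s, \<beta>)\<close>, meaningful for irrational \<open>\<beta>\<close>.\<close>

definition cot_dirichlet :: "nat \<Rightarrow> nat \<Rightarrow> real \<Rightarrow> real" where
  "cot_dirichlet k s \<beta> = (\<Sum>n=1..k. cot (pi * real n * \<beta>) / real n ^ s)"

text \<open>
  Bernoulli polynomials through the generating function \<open>t e\<^sup>t\<^sup>x / (e\<^sup>t - 1)\<close>, read as a quotient of
  formal power series in \<open>t\<close>. Both series have zero constant term, but the division is exact
  (\<open>bernoulli_poly_gen_fun\<close>).
\<close>

definition bernoulli_poly :: "nat \<Rightarrow> real \<Rightarrow> real" where
  "bernoulli_poly n x = fact n * fps_nth (fps_X * fps_exp x / (fps_exp 1 - 1)) n"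

lemma bernoulli_poly_gen_fun:
  "Abs_fps (\<lambda>n. bernoulli_poly n x / fact n) * (fps_exp 1 - 1) = fps_X * fps_exp x"
proof -
  have n1: "fps_nth (fps_exp 1 - 1 :: real fps) 1 = 1" by simp
  have nz: "(fps_exp 1 - 1 :: real fps) \<noteq> 0" using n1 by (metis fps_zero_nth zero_neq_one)
  have sd: "subdegree (fps_exp 1 - 1 :: real fps) = 1"
    by (rule subdegreeI) (use n1 in auto)
  have "fps_nth (fps_X * fps_exp x) 1 = 1" by simp
  then have nz2: "fps_X * fps_exp x \<noteq> 0" by (metis fps_zero_nth zero_neq_one)
  have "subdegree (fps_X * fps_exp x) \<ge> 1"
    by (rule subdegree_geI) (use nz2 in auto)
  with sd nz nz2 have "(fps_exp 1 - 1) dvd (fps_X * fps_exp x)"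
    by (simp add: fps_dvd_iff)
  moreover have "Abs_fps (\<lambda>n. bernoulli_poly n x / fact n) = fps_X * fps_exp x / (fps_exp 1 - 1)"
    by (simp add: fps_eq_iff bernoulli_poly_def)
  ultimately show ?thesis by simp
qed

lemma bernoulli_poly_0: "bernoulli_poly 0 x = 1"
proof -
  have "fps_nth (Abs_fps (\<lambda>n. bernoulli_poly n x / fact n) * (fps_exp 1 - 1)) 1 = 1"
    unfolding bernoulli_poly_gen_fun by simp
  then show ?thesis by (simp add: fps_mult_nth)
qed

end

theory Submission
  imports Defs "HOL-Complex_Analysis.Complex_Analysis"
begin

text \<open>
  The asymptotic formula is the residue theorem for
    \<open>F(t) = t\<^sup>1\<^sup>-\<^sup>2\<^sup>m (\<Sum>j mod c. exp (x j t) / (exp t - 1) * exp (y j \<eta> t) / (exp (\<eta> t) - 1))\<close>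
  on large circles around \<open>0\<close>. The residue at \<open>0\<close> is the Bernoulli sum (\<open>residue_at_0\<close>). At \<open>t = 2\<pi>in\<close> and
  at \<open>t = 2\<pi>in/\<eta>\<close> with \<open>n \<noteq> 0\<close> the sum over \<open>j\<close> is geometric (\<open>twisted_sum_at_int\<close>,
  \<open>twisted_sum_at_int_divide_eta\<close>) and collapses to \<open>1/(e(n\<alpha>) - 1)\<close> and to \<open>-1/(e(n V\<alpha>) - 1)\<close>, where
  \<open>e(u) = exp (2\<pi>iu)\<close>. Combining \<open>n\<close> with \<open>-n\<close> leaves the cotangents of \<open>\<pi>n\<alpha>\<close> and \<open>\<pi>nV\<alpha>\<close>, so the residues
  inside a circle add up to the two finite cotangent sums. These poles are simple because \<open>\<eta>\<close> is
  irrational.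

  For \<open>x\<close> between \<open>0\<close> and \<open>1\<close> the kernel \<open>e\<^sup>x\<^sup>t/(e\<^sup>t - 1)\<close> is bounded at any fixed distance from its
  poles. On a circle of radius \<open>r\<close> that stays at a fixed distance from all poles, \<open>F\<close> is thus \<open>O(r\<^sup>1\<^sup>-\<^sup>2\<^sup>m)\<close> and the integral is
  \<open>O(r\<^sup>2\<^sup>-\<^sup>2\<^sup>m)\<close> (\<open>cot_dirichlet_reciprocity_at_gap\<close>), which is \<open>O(1/k)\<close> for \<open>m \<ge> 2\<close>.

  The circle should pass immediately behind the pole \<open>2\<pi>ik/\<eta>\<close>, but the next pole \<open>2\<pi>i(K + 1)\<close> may be
  arbitrarily close. If it is, the circle passes behind both. The first sum then has the extra term
  with \<open>n = K + 1\<close>, which can be huge, and the correction term of the formula equals it up to a negligible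
  error (\<open>correction_cancels_cot\<close>). If it is not, the correction term is negligible (\<open>correction_small\<close>).
\<close>


section \<open>The kernel of the Bernoulli polynomials\<close>

definition bernoulli_kernel :: "real \<Rightarrow> complex \<Rightarrow> complex" where
  "bernoulli_kernel x t = exp (of_real x * t) / (exp t - 1)"

lemma exp_eq_1_iff_int: "exp t = 1 \<longleftrightarrow> (\<exists>n::int. t = of_real (2 * pi * of_int n) * \<i>)"
  unfolding exp_eq_1 by (auto simp: complex_eq_iff)

text \<open>
  If \<open>exp t\<close> is within \<open>1/2\<close> of \<open>1\<close>, its principal logarithm is \<open>t\<close> shifted by some \<open>2\<pi>in\<close> and has
  size at most \<open>2 |exp t - 1|\<close>; so \<open>exp t\<close> can be close to \<open>1\<close> only if \<open>t\<close> is close to a pole.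
\<close>

lemma norm_exp_minus_1_ge:
  fixes t :: complex
  assumes "\<And>n::int. \<delta> \<le> norm (t - of_real (2 * pi * of_int n) * \<i>)"
  shows "min (1/2) (\<delta>/2) \<le> norm (exp t - 1)"
proof (rule ccontr)
  assume "\<not> ?thesis"
  then have small: "norm (exp t - 1) < 1/2" "2 * norm (exp t - 1) < \<delta>" by auto
  have le: "norm (Ln (exp t)) \<le> 2 * norm (exp t - 1)"
    using norm_Ln_le[of "exp t - 1"] small by simp
  have "exp (Ln (exp t)) = exp t" by simp
  then obtain n :: int where "Ln (exp t) = t + (of_int (2 * n) * pi) * \<i>"
    unfolding exp_eq by blast
  then have "t - of_real (2 * pi * of_int (- n)) * \<i> = Ln (exp t)"
    by (simp add: algebra_simps)
  with assms[of "- n"] le small show False by simp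
qed

text \<open>
  The bound is uniform over unbounded \<open>t\<close>: for \<open>0 \<le> x \<le> 1\<close> the numerator is dominated by \<open>1\<close> or by
  \<open>|exp t|\<close>, depending on the sign of \<open>Re t\<close>, and in both cases by \<open>1 + |exp t - 1|\<close>.
\<close>

lemma norm_bernoulli_kernel_le:
  assumes "0 < \<delta>" and "\<And>n::int. \<delta> \<le> norm (t - of_real (2 * pi * of_int n) * \<i>)"
    and x: "0 \<le> x" "x \<le> 1"
  shows "norm (bernoulli_kernel x t) \<le> 1 + 1 / min (1/2) (\<delta>/2)"
proof -
  define \<epsilon> where "\<epsilon> = min (1/2) (\<delta>/2)"
  have \<epsilon>: "0 < \<epsilon>" "\<epsilon> \<le> norm (exp t - 1)"
    using norm_exp_minus_1_ge[OF assms(2)] assms(1) by (auto simp: \<epsilon>_def)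
  have "norm (exp (of_real x * t)) = exp (x * Re t)" by simp
  also have "\<dots> \<le> 1 + norm (exp t - 1)"
  proof (cases "Re t \<le> 0")
    case True
    then have "exp (x * Re t) \<le> 1" using x by (simp add: mult_nonneg_nonpos)
    then show ?thesis by (smt (verit) norm_ge_zero)
  next
    case False
    then have "exp (x * Re t) \<le> exp (Re t)" using x by (simp add: mult_left_le_one_le)
    also have "\<dots> = norm (exp t)" by simp
    also have "\<dots> \<le> 1 + norm (exp t - 1)"
      using norm_triangle_ineq[of 1 "exp t - 1"] by simp
    finally show ?thesis .
  qed
  finally have "norm (bernoulli_kernel x t) \<le> (1 + norm (exp t - 1)) / norm (exp t - 1)"
    using \<epsilon> by (simp add: bernoulli_kernel_def norm_divide divide_right_mono)
  also have "\<dots> = 1 + 1 / norm (exp t - 1)"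
    using \<epsilon> by (subst add_divide_distrib) auto
  also have "\<dots> \<le> 1 + 1 / \<epsilon>"
    using \<epsilon> by (simp add: frac_le)
  finally show ?thesis by (simp add: \<epsilon>_def)
qed

text \<open>
  Transfers the formal generating function of the Bernoulli polynomials, which lives over the reals,
  to a convergent power series of a complex function.
\<close>

lemma bernoulli_kernel_has_fps_expansion:
  "(\<lambda>t. if t = 0 then 1 else t * bernoulli_kernel x t) has_fps_expansion
     Abs_fps (\<lambda>n. of_real (bernoulli_poly n x / fact n))"
proof -
  define G :: "complex fps" where "G = Abs_fps (\<lambda>n. of_real (bernoulli_poly n x / fact n))"
  have gen: "G * (fps_exp 1 - 1) = fps_X * fps_exp (of_real x)"
  proof (rule fps_ext)
    fix n
    have "fps_nth (G * (fps_exp 1 - 1)) n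
        = of_real (fps_nth (Abs_fps (\<lambda>n. bernoulli_poly n x / fact n) * (fps_exp 1 - 1)) n)"
      by (simp add: G_def fps_mult_nth if_distrib[of of_real] cong: if_cong)
    also have "\<dots> = fps_nth (fps_X * fps_exp (of_real x)) n"
      unfolding bernoulli_poly_gen_fun by (simp add: fps_X_mult_nth)
    finally show "fps_nth (G * (fps_exp 1 - 1)) n = fps_nth (fps_X * fps_exp (of_real x)) n" .
  qed
  have "fps_nth (fps_exp 1 - 1 :: complex fps) 1 = 1" by simp
  then have nz: "(fps_exp 1 - 1 :: complex fps) \<noteq> 0" by (metis fps_zero_nth zero_neq_one)
  have sd: "subdegree (fps_exp 1 - 1 :: complex fps) = 1"
    by (rule subdegreeI) auto
  have nzX: "fps_X * fps_exp (of_real x) \<noteq> (0 :: complex fps)"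
  proof
    assume "fps_X * fps_exp (of_real x) = (0 :: complex fps)"
    then have "fps_nth (fps_X * fps_exp (of_real x)) 1 = (0 :: complex)" by simp
    then show False by simp
  qed
  have "(\<lambda>t. if t = 0 then 1 else (t * exp (complex_of_real x * t)) / (exp t - 1))
      has_fps_expansion (fps_X * fps_exp (of_real x) / (fps_exp 1 - 1))"
  proof (rule has_fps_expansion_divide)
    show "subdegree (fps_exp 1 - 1 :: complex fps) \<le> subdegree (fps_X * fps_exp (complex_of_real x))"
      unfolding sd by (rule subdegree_geI) (use nzX in auto)
    show "1 = fps_nth (fps_X * fps_exp (complex_of_real x)) (subdegree (fps_exp 1 - 1 :: complex fps)) 
       / fps_nth (fps_exp 1 - 1) (subdegree (fps_exp 1 - 1 :: complex fps))"
      unfolding sd by simp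
  qed (use nz in \<open>auto intro!: fps_expansion_intros\<close>)
  moreover have "fps_X * fps_exp (of_real x) / (fps_exp 1 - 1) = G"
    unfolding gen[symmetric] using nz by simp
  ultimately show ?thesis by (simp only: G_def bernoulli_kernel_def times_divide_eq_right)
qed

text \<open>
  The residues at \<open>2\<pi>in\<close> and \<open>-2\<pi>in\<close> enter with opposite signs because the power of \<open>t\<close> is odd, and this
  is the combination that they form. At \<open>sin \<phi> = 0\<close> both sides vanish, division by zero being zero.
\<close>

lemma odd_part_geometric_eq_cot:
  "1 / (cis (2 * \<phi>) - 1) - 1 / (cis (- (2 * \<phi>)) - 1) = - \<i> * of_real (cot \<phi>)"
proof (cases "sin \<phi> = 0")
  case True
  then have "cis (2 * \<phi>) = 1" by (simp add: complex_eq_iff cos_double_sin sin_double)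
  with True show ?thesis by (simp add: cot_def cis_cnj[symmetric])
next
  case False
  define u where "u = cis \<phi>"
  have inv: "1 / u = cis (- \<phi>)" by (simp add: u_def divide_inverse)
  have u: "u \<noteq> 0" "cis (2 * \<phi>) = u * u" "cis (- (2 * \<phi>)) = 1 / u * (1 / u)"
    unfolding inv by (simp_all add: u_def cis_mult)
  have du: "u - 1 / u = 2 * \<i> * of_real (sin \<phi>)" "u + 1 / u = 2 * of_real (cos \<phi>)"
    unfolding inv by (simp_all add: u_def complex_eq_iff)
  have nz: "u * u - 1 \<noteq> 0" using du(1) False u(1) by (auto simp: field_simps)
  have "1 / (u * u - 1) - 1 / (1 / u * (1 / u) - 1) = (u + 1 / u) / (u - 1 / u)"
    using u nz by (simp add: divide_simps) (simp add: algebra_simps)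
  also have "\<dots> = - \<i> * of_real (cot \<phi>)"
    unfolding du using False by (simp add: cot_def field_simps)
  finally show ?thesis using u by simp
qed

section \<open>Roots of unity and sums over symmetric intervals\<close>

lemma cis_eq_cis_int_shift:
  assumes "u - v \<in> \<int>"
  shows "cis (2 * pi * u) = cis (2 * pi * v)"
proof -
  obtain k :: int where k: "u = v + of_int k"
    using assms by (metis Ints_cases diff_add_cancel add.commute)
  then have "cis (2 * pi * u) = cis (2 * pi * v) * cis (2 * pi * of_int k)"
    unfolding cis_mult k by (simp only: distrib_left)
  then show ?thesis by (simp only: cis_multiple_2pi Ints_of_int mult_1_right)
qed

lemma cis_power_nat_int:
  assumes "0 \<le> j"
  shows "cis u ^ nat j = cis (of_int j * u)"
  using assms by (simp add: Complex.DeMoivre)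

lemma sum_power_int_interval:
  fixes q :: complex
  assumes "q \<noteq> 1"
  shows "(\<Sum>j\<in>{0..<c::int}. q ^ nat j) = (q ^ nat c - 1) / (q - 1)"
proof -
  have "(\<Sum>j\<in>{0..<c}. q ^ nat j) = (\<Sum>i<nat c. q ^ i)"
    by (rule sum.reindex_bij_witness[of _ int nat]) auto
  with geometric_sum[OF assms] show ?thesis by simp
qed

lemma frac_of_int_divide:
  fixes k c :: int
  assumes "c > 0"
  shows "frac (of_int k / of_int c :: real) = of_int (k mod c) / of_int c"
proof -
  have "real_of_int k = of_int (k div c) * of_int c + of_int (k mod c)"
    by (metis div_mult_mod_eq of_int_add of_int_mult)
  then have "real_of_int k / of_int c = of_int (k div c) + of_int (k mod c) / of_int c"
    using assms by (simp add: field_simps)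
  then show ?thesis by (simp add: frac_def floor_divide_of_int_eq)
qed

lemma cis_ne_1: "u \<notin> \<int> \<Longrightarrow> cis (2 * pi * u) \<noteq> 1"
proof
  assume "u \<notin> \<int>" "cis (2 * pi * u) = 1"
  then have "exp (\<i> * of_real (2 * pi * u)) = 1" by (simp add: cis_conv_exp)
  then obtain n :: int where "2 * pi * u = 2 * pi * of_int n"
    unfolding exp_eq_1 by (auto simp: algebra_simps)
  then have "u = of_int n" by simp
  with \<open>u \<notin> \<int>\<close> show False by simp
qed

lemma exp_eq_cis: "exp (of_real (2 * pi * u) * \<i>) = cis (2 * pi * u)"
  by (simp add: cis_conv_exp mult.commute)

lemma sum_symmetric_int_interval:
  fixes h :: "int \<Rightarrow> 'a::comm_monoid_add"
  shows "(\<Sum>n\<in>{- int N..int N} - {0}. h n) = (\<Sum>n=1..N. h (int n) + h (- int n))"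
proof (induction N)
  case (Suc N)
  have "{- int (Suc N)..int (Suc N)} - {0}
      = insert (int (Suc N)) (insert (- int (Suc N)) ({- int N..int N} - {0}))" by auto
  then show ?case using Suc by (simp add: algebra_simps)
qed simp

lemma mem_symmetric_int_interval_iff:
  assumes "0 \<le> u"
  shows "n \<in> {- int (nat \<lfloor>u\<rfloor>)..int (nat \<lfloor>u\<rfloor>)} \<longleftrightarrow> \<bar>real_of_int n\<bar> \<le> u"
proof -
  have "n \<in> {- int (nat \<lfloor>u\<rfloor>)..int (nat \<lfloor>u\<rfloor>)} \<longleftrightarrow> \<bar>n\<bar> \<le> \<lfloor>u\<rfloor>" using assms by auto
  then show ?thesis by (simp add: le_floor_iff)
qed

lemma sum_symmetric_residues_eq_cot_dirichlet:
  assumes "m \<ge> 1"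
  shows "(\<Sum>n\<in>{- int N..int N} - {0}.
      1 / (of_real (2 * pi * of_int n) * \<i>) ^ (2 * m - 1) * (1 / (cis (2 * pi * (of_int n * \<beta>)) - 1)))
    = of_real ((- 1) ^ m / (2 * pi) ^ (2 * m - 1) * cot_dirichlet N (2 * m - 1) \<beta>)"
proof -
  have odd: "odd (2 * m - 1)" using assms by simp
  have i: "\<i> ^ (2 * m - 1) = (- 1) ^ m * (- \<i>)"
  proof -
    have "\<i> ^ (2 * m - 1) * \<i> = \<i> ^ (2 * m)" using assms by (simp flip: power_Suc2)
    also have "\<dots> = (- 1) ^ m" by (simp add: power_mult)
    finally have "\<i> ^ (2 * m - 1) * \<i> * (- \<i>) = (- 1) ^ m * (- \<i>)" by simp
    then show ?thesis by (simp only: mult.assoc) simp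
  qed
  have "(\<Sum>n\<in>{- int N..int N} - {0}.
      1 / (of_real (2 * pi * of_int n) * \<i>) ^ (2 * m - 1) * (1 / (cis (2 * pi * (of_int n * \<beta>)) - 1)))
    = (\<Sum>n=1..N. of_real ((- 1) ^ m / (2 * pi) ^ (2 * m - 1) * (cot (pi * real n * \<beta>) / real n ^ (2 * m - 1))))"
    unfolding sum_symmetric_int_interval
  proof (intro sum.cong refl)
    fix n assume n: "n \<in> {1..N}"
    define z where "z = (of_real (2 * pi * real n) * \<i>) ^ (2 * m - 1)"
    define \<phi> where "\<phi> = pi * real n * \<beta>"
    have z': "(of_real (2 * pi * of_int (- int n)) * \<i>) ^ (2 * m - 1) = - z"
      unfolding z_def power_minus_odd[OF odd, symmetric] by simp
    have z: "z = of_real ((2 * pi) ^ (2 * m - 1) * real n ^ (2 * m - 1)) * ((- 1) ^ m * (- \<i>))"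
      unfolding z_def power_mult_distrib i by (simp add: power_mult_distrib)
    have "1 / z * (1 / (cis (2 * \<phi>) - 1)) + 1 / (- z) * (1 / (cis (- (2 * \<phi>)) - 1))
       = 1 / z * (1 / (cis (2 * \<phi>) - 1) - 1 / (cis (- (2 * \<phi>)) - 1))"
      by (simp add: algebra_simps)
    also have "\<dots> = 1 / z * (- \<i> * of_real (cot \<phi>))"
      by (simp only: odd_part_geometric_eq_cot)
    also have "\<dots> = of_real ((- 1) ^ m / (2 * pi) ^ (2 * m - 1) * (cot \<phi> / real n ^ (2 * m - 1)))"
      unfolding z using n by (cases "even m") (auto simp: field_simps)
    finally show "1 / (of_real (2 * pi * of_int (int n)) * \<i>) ^ (2 * m - 1) * (1 / (cis (2 * pi * (of_int (int n) * \<beta>)) - 1))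
        + 1 / (of_real (2 * pi * of_int (- int n)) * \<i>) ^ (2 * m - 1) * (1 / (cis (2 * pi * (of_int (- int n) * \<beta>)) - 1))
      = of_real ((- 1) ^ m / (2 * pi) ^ (2 * m - 1) * (cot (pi * real n * \<beta>) / real n ^ (2 * m - 1)))"
      unfolding z' unfolding z_def \<phi>_def by (simp add: mult_ac)
  qed
  then show ?thesis by (simp add: cot_dirichlet_def sum_distrib_left)
qed

section \<open>Geometric sums over residues modulo c\<close>

locale cot_reciprocity =
  fixes \<alpha> \<eta> V\<alpha> :: real and a b c d :: int and m :: nat and x y :: "int \<Rightarrow> real"
  assumes irrational: "\<alpha> \<notin> \<rat>"
    and det: "a * d - b * c = 1" and c_pos: "c > 0"
    and V\<alpha>_eq: "V\<alpha> = (of_int a * \<alpha> + of_int b) / (of_int c * \<alpha> + of_int d)"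
    and \<eta>_eq: "\<eta> = of_int c * \<alpha> + of_int d" and \<eta>_pos: "\<eta> > 0"
    and m_ge: "m \<ge> 1"
    and x_eq: "x j = 1 - frac (of_int (d * j) / of_int c)"
    and y_eq: "y j = frac (of_int j / of_int c)"
begin

lemma x_bounds: "0 \<le> x j" "x j \<le> 1" and y_bounds: "0 \<le> y j" "y j \<le> 1"
  using frac_lt_1[of "of_int (d * j) / of_int c :: real"] frac_lt_1[of "of_int j / of_int c :: real"]
  by (auto simp: x_eq y_eq intro: less_imp_le)

lemma eta_irrational: "\<eta> \<notin> \<rat>"
proof
  assume "\<eta> \<in> \<rat>"
  then have "(\<eta> - of_int d) / of_int c \<in> \<rat>" by simp
  with c_pos irrational show False by (simp add: \<eta>_eq)
qed

lemma eta_times_int_notin_Ints: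
  assumes "n \<noteq> 0"
  shows "\<eta> * of_int n \<notin> \<int>"
proof
  assume "\<eta> * of_int n \<in> \<int>"
  then have "\<eta> * of_int n / of_int n \<in> \<rat>" using Ints_subset_Rats by (intro Rats_divide) auto
  with assms eta_irrational show False by simp
qed

lemma int_divide_eta_notin_Ints:
  assumes "n \<noteq> 0"
  shows "of_int n / \<eta> \<notin> \<int>"
proof
  assume "of_int n / \<eta> \<in> \<int>"
  then obtain k where k: "of_int n / \<eta> = of_int k" by (rule Ints_cases)
  then have "\<eta> * of_int k = of_int n" using \<eta>_pos by (simp add: field_simps)
  moreover have "k \<noteq> 0" using k assms \<eta>_pos by auto
  ultimately show False using eta_times_int_notin_Ints[of k] by auto
qed

text \<open>
  At \<open>t = 2\<pi>in\<close> the shifts \<open>x j\<close> contribute \<open>exp (-2\<pi>indj/c)\<close> and the shifts \<open>y j\<close> contribute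
  \<open>exp (2\<pi>in\<eta>j/c)\<close>. As \<open>(\<eta> - d)/c = \<alpha>\<close>, the terms are \<open>q\<^sup>j / (q\<^sup>c - 1)\<close> with \<open>q = exp (2\<pi>in\<alpha>)\<close>, a geometric
  series that collapses to a single fraction.
\<close>

lemma twisted_sum_at_int:
  fixes n :: int
  assumes n: "n \<noteq> 0" and t: "t = of_real (2 * pi * of_int n) * \<i>"
  defines "q \<equiv> cis (2 * pi * (of_int n * \<alpha>))"
  shows "q \<noteq> 1"
    and "(\<Sum>j\<in>{0..<c}. exp (of_real (x j) * t) * bernoulli_kernel (y j) (of_real \<eta> * t)) = 1 / (q - 1)"
proof -
  define D where "D = exp (of_real \<eta> * t)"
  have D: "D = cis (2 * pi * (\<eta> * of_int n))"
    unfolding D_def t exp_eq_cis[symmetric] by (simp add: mult_ac)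
  have D1: "D \<noteq> 1"
    unfolding D using eta_times_int_notin_Ints[OF n] by (rule cis_ne_1)
  have qc: "q ^ nat c = D"
  proof -
    have "q ^ nat c = cis (2 * pi * (of_int c * (of_int n * \<alpha>)))"
      using c_pos unfolding q_def by (subst cis_power_nat_int) (simp_all add: mult_ac)
    also have "\<dots> = D"
      unfolding D by (rule cis_eq_cis_int_shift) (simp add: \<eta>_eq algebra_simps flip: of_int_mult)
    finally show ?thesis .
  qed
  show q1: "q \<noteq> 1" using qc D1 by auto
  have summand: "exp (of_real (x j) * t) * bernoulli_kernel (y j) (of_real \<eta> * t) = q ^ nat j / (D - 1)"
    if j: "j \<in> {0..<c}" for j
  proof -
    have yj: "y j = of_int j / of_int c" using j by (simp add: y_eq frac_of_int_divide)
    have "exp (of_real (x j) * t) * exp (of_real (y j) * (of_real \<eta> * t))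
        = exp (of_real (2 * pi * ((x j + y j * \<eta>) * of_int n)) * \<i>)"
      unfolding t exp_add[symmetric] by (simp add: algebra_simps)
    also have "\<dots> = cis (2 * pi * ((x j + y j * \<eta>) * of_int n))"
      by (rule exp_eq_cis)
    also have "\<dots> = cis (2 * pi * (of_int j * (of_int n * \<alpha>)))"
    proof (rule cis_eq_cis_int_shift)
      have "(x j + y j * \<eta>) * of_int n - of_int j * (of_int n * \<alpha>)
          = (1 + of_int \<lfloor>of_int (d * j) / of_int c :: real\<rfloor>) * of_int n"
        using c_pos unfolding x_eq yj \<eta>_eq frac_def by (simp add: field_simps)
      then show "(x j + y j * \<eta>) * of_int n - of_int j * (of_int n * \<alpha>) \<in> \<int>" by simp
    qed
    also have "\<dots> = q ^ nat j" using j unfolding q_def by (subst cis_power_nat_int) (simp_all add: mult_ac)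
    finally show ?thesis by (simp add: bernoulli_kernel_def D_def)
  qed
  have "(\<Sum>j\<in>{0..<c}. exp (of_real (x j) * t) * bernoulli_kernel (y j) (of_real \<eta> * t))
      = (\<Sum>j\<in>{0..<c}. q ^ nat j) / (D - 1)"
    by (simp add: summand sum_divide_distrib)
  also have "\<dots> = 1 / (q - 1)"
    using D1 by (simp add: sum_power_int_interval[OF q1] qc)
  finally show "(\<Sum>j\<in>{0..<c}. exp (of_real (x j) * t) * bernoulli_kernel (y j) (of_real \<eta> * t)) = 1 / (q - 1)" .
qed

text \<open>
  The mirror image at \<open>t = 2\<pi>in/\<eta>\<close>. Summing over \<open>i = dj mod c\<close> instead of \<open>j\<close>, with inverse
  \<open>j = ai mod c\<close>, turns the terms into powers of \<open>p = exp (2\<pi>in V\<alpha>)\<close>, because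
  \<open>V\<alpha> = a/c - 1/(c\<eta>)\<close>.
\<close>

lemma twisted_sum_at_int_divide_eta:
  fixes n :: int
  assumes n: "n \<noteq> 0" and t: "t = of_real (2 * pi * (of_int n / \<eta>)) * \<i>"
  defines "p \<equiv> cis (2 * pi * (of_int n * V\<alpha>))"
  shows "p \<noteq> 1"
    and "(\<Sum>j\<in>{0..<c}. bernoulli_kernel (x j) t * exp (of_real (y j) * (of_real \<eta> * t))) = - 1 / (p - 1)"
proof -
  define E where "E = exp t"
  have E: "E = cis (2 * pi * (of_int n / \<eta>))"
    unfolding E_def t by (rule exp_eq_cis)
  have E1: "E \<noteq> 1" "E \<noteq> 0"
    unfolding E using int_divide_eta_notin_Ints[OF n] by (rule cis_ne_1) simp
  have V: "V\<alpha> = of_int a / of_int c - 1 / (of_int c * \<eta>)"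
  proof -
    have "a * d = 1 + b * c" using det by simp
    then have "real_of_int (a * d) = of_int (1 + b * c)" by (simp only:)
    then have "of_int c * (of_int a * \<alpha> + of_int b) = of_int a * \<eta> - 1"
      unfolding \<eta>_eq by (simp add: algebra_simps)
    then have "of_int a * \<alpha> + of_int b = (of_int a * \<eta> - 1) / of_int c"
      using c_pos by (simp add: field_simps)
    then have "V\<alpha> = (of_int a * \<eta> - 1) / of_int c / \<eta>"
      unfolding V\<alpha>_eq \<eta>_eq[symmetric] by (simp only:)
    then show ?thesis using c_pos \<eta>_pos by (simp add: field_simps)
  qed
  have pc: "p ^ nat c = 1 / E"
  proof -
    have "p ^ nat c = cis (2 * pi * (of_int c * (of_int n * V\<alpha>)))"
      using c_pos unfolding p_def by (subst cis_power_nat_int) (simp_all add: mult_ac)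
    also have "\<dots> = cis (2 * pi * (- (of_int n / \<eta>)))"
    proof (rule cis_eq_cis_int_shift)
      have "of_int c * (of_int n * V\<alpha>) - - (of_int n / \<eta>) = of_int (a * n)"
        using c_pos \<eta>_pos by (simp add: V field_simps)
      then show "of_int c * (of_int n * V\<alpha>) - - (of_int n / \<eta>) \<in> \<int>" by simp
    qed
    also have "\<dots> = 1 / E" by (simp add: E divide_inverse)
    finally show ?thesis .
  qed
  show p1: "p \<noteq> 1" using pc E1 by auto
  have summand: "bernoulli_kernel (x j) t * exp (of_real (y j) * (of_real \<eta> * t))
      = E / (E - 1) * p ^ nat ((d * j) mod c)"
    if j: "j \<in> {0..<c}" for j
  proof -
    define i where "i = (d * j) mod c"
    have i: "0 \<le> i" using c_pos by (simp add: i_def)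
    have yj: "y j = of_int j / of_int c" using j by (simp add: y_eq frac_of_int_divide)
    have xj: "x j = 1 - of_int i / of_int c"
      using c_pos by (simp only: x_eq frac_of_int_divide i_def)
    have "c dvd j - a * i"
    proof -
      have "(a * i) mod c = (a * (d * j)) mod c"
        unfolding i_def by (simp add: mod_mult_right_eq)
      also have "a * (d * j) = j + c * (b * j)" using det by algebra
      also have "(j + c * (b * j)) mod c = j mod c" by simp
      finally show ?thesis by (metis mod_eq_dvd_iff)
    qed
    then obtain r where r: "j = a * i + c * r" by (metis dvdE diff_add_cancel add.commute)
    have "exp (of_real (x j) * t) * exp (of_real (y j) * (of_real \<eta> * t))
        = exp (of_real (2 * pi * ((x j / \<eta> + y j) * of_int n)) * \<i>)"
      using \<eta>_pos unfolding t exp_add[symmetric] by (simp add: field_simps)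
    also have "\<dots> = cis (2 * pi * ((x j / \<eta> + y j) * of_int n))"
      by (rule exp_eq_cis)
    also have "\<dots> = cis (2 * pi * (of_int n / \<eta> + of_int i * (of_int n * V\<alpha>)))"
    proof (rule cis_eq_cis_int_shift)
      have "(x j / \<eta> + y j) * of_int n - (of_int n / \<eta> + of_int i * (of_int n * V\<alpha>))
          = of_int (r * n)"
        using c_pos \<eta>_pos unfolding xj yj V by (simp add: r field_simps)
      then show "(x j / \<eta> + y j) * of_int n - (of_int n / \<eta> + of_int i * (of_int n * V\<alpha>)) \<in> \<int>"
        by simp
    qed
    also have "\<dots> = E * p ^ nat i"
      unfolding E p_def cis_power_nat_int[OF i] cis_mult by (simp add: algebra_simps)
    finally show ?thesis by (simp add: bernoulli_kernel_def E_def i_def)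
  qed
  have bij: "(\<Sum>j\<in>{0..<c}. p ^ nat ((d * j) mod c)) = (\<Sum>i\<in>{0..<c}. p ^ nat i)"
  proof (rule sum.reindex_bij_witness[of _ "\<lambda>i. (a * i) mod c" "\<lambda>j. (d * j) mod c"])
    have inv: "(a * (d * j)) mod c = j" if "j \<in> {0..<c}" for j
    proof -
      have "a * (d * j) = j + c * (b * j)" using det by algebra
      with that show ?thesis by simp
    qed
    show "a * (d * j mod c) mod c = j" if "j \<in> {0..<c}" for j
      using inv[OF that] by (simp add: mod_mult_right_eq)
    show "d * (a * j mod c) mod c = j" if "j \<in> {0..<c}" for j
      using inv[OF that] by (simp add: mod_mult_right_eq mult.left_commute)
  qed (use c_pos in auto)
  have "(\<Sum>j\<in>{0..<c}. bernoulli_kernel (x j) t * exp (of_real (y j) * (of_real \<eta> * t)))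
      = E / (E - 1) * (\<Sum>j\<in>{0..<c}. p ^ nat ((d * j) mod c))"
    by (simp add: summand sum_distrib_left)
  also have "\<dots> = E / (E - 1) * ((1 / E - 1) / (p - 1))"
    unfolding bij by (simp add: sum_power_int_interval[OF p1] pc)
  also have "\<dots> = - 1 / (p - 1)"
    using E1 p1 by (simp add: divide_simps)
  finally show "(\<Sum>j\<in>{0..<c}. bernoulli_kernel (x j) t * exp (of_real (y j) * (of_real \<eta> * t))) = - 1 / (p - 1)" .
qed

section \<open>Residues of the reciprocity function\<close>

definition reciprocity_fun :: "complex \<Rightarrow> complex" where
  "reciprocity_fun t =
     (\<Sum>j\<in>{0..<c}. bernoulli_kernel (x j) t * bernoulli_kernel (y j) (of_real \<eta> * t)) / t ^ (2 * m - 1)"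

definition bernoulli_sum :: real where
  "bernoulli_sum = (\<Sum>l=0..2*m. \<Sum>j\<in>{0..<c}.
              bernoulli_poly l (x j) * bernoulli_poly (2 * m - l) (y j)
                / (fact l * fact (2 * m - l))
              * \<eta> powi (2 * int m - int l - 1))"

text \<open>
  Near \<open>0\<close> each kernel is a Bernoulli generating function divided by its argument, so the residue is the
  coefficient of \<open>t\<^sup>2\<^sup>m\<close> in the products of the generating functions at \<open>t\<close> and \<open>\<eta>t\<close>, divided by \<open>\<eta>\<close>.
\<close>

lemma residue_at_0: "residue reciprocity_fun 0 = of_real bernoulli_sum"
proof -
  define B :: "real \<Rightarrow> complex fps" where "B x = Abs_fps (\<lambda>n. of_real (bernoulli_poly n x / fact n))" for x
  define g where "g x t = (if t = 0 then 1 else t * bernoulli_kernel x t)" for x t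
  have g: "g x has_fps_expansion B x" for x
    unfolding g_def B_def by (rule bernoulli_kernel_has_fps_expansion)
  have "(g x \<circ> (\<lambda>t. of_real \<eta> * t)) has_fps_expansion (B x oo (fps_const (of_real \<eta>) * fps_X))" for x
    by (rule has_fps_expansion_compose[OF g]) (auto intro!: fps_expansion_intros)
  then have g\<eta>: "(\<lambda>t. g x (of_real \<eta> * t)) has_fps_expansion (B x oo (fps_const (of_real \<eta>) * fps_X))" for x
    by (simp add: o_def)
  define H where "H = (\<lambda>t. \<Sum>j\<in>{0..<c}. g (x j) t * g (y j) (of_real \<eta> * t))"
  have "H has_fps_expansion (\<Sum>j\<in>{0..<c}. B (x j) * (B (y j) oo (fps_const (of_real \<eta>) * fps_X)))"
    unfolding H_def by (intro has_fps_expansion_sum has_fps_expansion_mult g g\<eta>)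
  then have H: "(\<lambda>t. inverse (of_real \<eta>) * H t) has_fps_expansion fps_const (inverse (of_real \<eta>)) *
      (\<Sum>j\<in>{0..<c}. B (x j) * (B (y j) oo (fps_const (of_real \<eta>) * fps_X)))"
    by (intro has_fps_expansion_mult has_fps_expansion_const)
  have "residue reciprocity_fun 0 = residue (\<lambda>t. (inverse (of_real \<eta>) * H t) / t ^ Suc (2 * m)) 0"
  proof (rule residue_cong)
    have "reciprocity_fun t = inverse (of_real \<eta>) * H t / t ^ Suc (2 * m)" if "t \<noteq> 0" for t
    proof -
      have "H t = of_real \<eta> * t ^ 2 *
          (\<Sum>j\<in>{0..<c}. bernoulli_kernel (x j) t * bernoulli_kernel (y j) (of_real \<eta> * t))"
        using that \<eta>_pos by (simp add: H_def g_def sum_distrib_left power2_eq_square mult_ac)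
      moreover have "t ^ Suc (2 * m) = t ^ 2 * t ^ (2 * m - 1)"
        using m_ge by (simp flip: power_add)
      ultimately show ?thesis using that \<eta>_pos by (simp add: reciprocity_fun_def)
    qed
    then show "\<forall>\<^sub>F t in at 0. reciprocity_fun t = inverse (of_real \<eta>) * H t / t ^ Suc (2 * m)"
      by (auto simp: eventually_at intro!: exI[of _ 1])
  qed simp
  also have "\<dots> = inverse (of_real \<eta>) * (\<Sum>j\<in>{0..<c}. \<Sum>l=0..2*m.
      of_real (bernoulli_poly l (x j) / fact l) * (of_real \<eta> ^ (2 * m - l) *
      of_real (bernoulli_poly (2 * m - l) (y j) / fact (2 * m - l))))"
    unfolding residue_fps_expansion_over_power_at_0[OF H] fps_mult_left_const_nth fps_sum_nth
    by (simp only: fps_mult_nth fps_nth_compose_linear B_def fps_nth_Abs_fps)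
  also have "\<dots> = of_real (\<Sum>j\<in>{0..<c}. \<Sum>l=0..2*m. inverse \<eta> * (bernoulli_poly l (x j) / fact l * (\<eta> ^ (2 * m - l) *
      (bernoulli_poly (2 * m - l) (y j) / fact (2 * m - l)))))"
    by (simp add: sum_distrib_left)
  also have "(\<Sum>j\<in>{0..<c}. \<Sum>l=0..2*m. inverse \<eta> * (bernoulli_poly l (x j) / fact l * (\<eta> ^ (2 * m - l) *
      (bernoulli_poly (2 * m - l) (y j) / fact (2 * m - l))))) = bernoulli_sum"
    unfolding bernoulli_sum_def
  proof (subst sum.swap, intro sum.cong refl)
    fix l j assume l: "l \<in> {0..2*m}"
    have e: "2 * int m - int l - 1 = int (2 * m - l) - 1" using l by auto
    have "\<eta> \<noteq> 0 \<or> int (2 * m - l) \<noteq> 1" using \<eta>_pos by simp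
    then have "\<eta> powi (2 * int m - int l - 1) = \<eta> ^ (2 * m - l) * inverse \<eta>"
      unfolding e by (simp only: power_int_diff power_int_of_nat power_int_1_right divide_inverse)
    then show "inverse \<eta> * (bernoulli_poly l (x j) / fact l * (\<eta> ^ (2 * m - l) *
      (bernoulli_poly (2 * m - l) (y j) / fact (2 * m - l)))) =
      bernoulli_poly l (x j) * bernoulli_poly (2 * m - l) (y j)
                / (fact l * fact (2 * m - l)) * \<eta> powi (2 * int m - int l - 1)"
      by (simp add: mult_ac)
  qed
  finally show ?thesis .
qed

lemma residue_at_int:
  fixes n :: int
  assumes n: "n \<noteq> 0"
  shows "residue reciprocity_fun (of_real (2 * pi * of_int n) * \<i>)
      = 1 / (of_real (2 * pi * of_int n) * \<i>) ^ (2 * m - 1) * (1 / (cis (2 * pi * (of_int n * \<alpha>)) - 1))"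
proof -
  define z where "z = of_real (2 * pi * of_int n) * \<i>"
  define f where "f t = (\<Sum>j\<in>{0..<c}. exp (of_real (x j) * t) * bernoulli_kernel (y j) (of_real \<eta> * t))
      / t ^ (2 * m - 1)" for t
  note tw = twisted_sum_at_int[OF n z_def]
  define U where "U = {t. t * (exp (of_real \<eta> * t) - 1) \<noteq> (0::complex)}"
  have "open U" unfolding U_def by (intro open_Collect_neq continuous_intros)
  moreover have "z \<in> U"
  proof -
    have "exp (of_real \<eta> * z) = cis (2 * pi * (\<eta> * of_int n))"
      unfolding z_def exp_eq_cis[symmetric] by (simp add: mult_ac)
    with cis_ne_1[OF eta_times_int_notin_Ints[OF n]] n show ?thesis by (simp add: U_def z_def)
  qed
  ultimately obtain e where e: "e > 0" "ball z e \<subseteq> U" by (auto simp: open_contains_ball)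
  have "residue (\<lambda>t. f t / (exp t - 1)) z = f z / 1"
  proof (rule residue_simple_pole_deriv)
    show "f holomorphic_on ball z e"
      using e(2) unfolding f_def bernoulli_kernel_def U_def by (auto intro!: holomorphic_intros)
    show "f z \<noteq> 0"
      using tw n by (simp add: f_def z_def)
    show "exp z - 1 = 0"
      unfolding z_def exp_eq_cis by simp
    then show "((\<lambda>t. exp t - 1) has_field_derivative 1) (at z)"
      by (auto intro!: derivative_eq_intros)
  qed (use e in \<open>auto intro!: holomorphic_intros\<close>)
  moreover have "(\<lambda>t. f t / (exp t - 1)) = reciprocity_fun"
    by (auto simp: f_def reciprocity_fun_def bernoulli_kernel_def fun_eq_iff sum_divide_distrib mult_ac)
  ultimately show ?thesis
    using tw by (simp only: f_def z_def[symmetric] div_by_1) simp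
qed

lemma residue_at_int_divide_eta:
  fixes n :: int
  assumes n: "n \<noteq> 0"
  shows "residue reciprocity_fun (of_real (2 * pi * (of_int n / \<eta>)) * \<i>)
      = - (of_real \<eta> ^ (2 * m - 2)) / (of_real (2 * pi * of_int n) * \<i>) ^ (2 * m - 1)
          * (1 / (cis (2 * pi * (of_int n * V\<alpha>)) - 1))"
proof -
  define z where "z = of_real (2 * pi * (of_int n / \<eta>)) * \<i>"
  define f where "f t = (\<Sum>j\<in>{0..<c}. bernoulli_kernel (x j) t * exp (of_real (y j) * (of_real \<eta> * t)))
      / t ^ (2 * m - 1)" for t
  note tw = twisted_sum_at_int_divide_eta[OF n z_def]
  define U where "U = {t. t * (exp t - 1) \<noteq> (0::complex)}"
  have "open U" unfolding U_def by (intro open_Collect_neq continuous_intros)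
  moreover have "z \<in> U"
  proof -
    have "exp z = cis (2 * pi * (of_int n / \<eta>))"
      unfolding z_def by (rule exp_eq_cis)
    with cis_ne_1[OF int_divide_eta_notin_Ints[OF n]] n \<eta>_pos show ?thesis by (simp add: U_def z_def)
  qed
  ultimately obtain e where e: "e > 0" "ball z e \<subseteq> U" by (auto simp: open_contains_ball)
  have ez: "exp (of_real \<eta> * z) = 1"
  proof -
    have "of_real \<eta> * z = of_real (2 * pi * of_int n) * \<i>" using \<eta>_pos by (simp add: z_def)
    then show ?thesis unfolding exp_eq_1_iff_int by blast
  qed
  have "residue (\<lambda>t. f t / (exp (of_real \<eta> * t) - 1)) z = f z / of_real \<eta>"
  proof (rule residue_simple_pole_deriv)
    show "f holomorphic_on ball z e"
      using e(2) unfolding f_def bernoulli_kernel_def U_def by (auto intro!: holomorphic_intros)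
    show "f z \<noteq> 0"
      using tw n \<eta>_pos by (simp add: f_def z_def)
    show "((\<lambda>t. exp (of_real \<eta> * t) - 1) has_field_derivative of_real \<eta>) (at z)"
      using ez by (auto intro!: derivative_eq_intros)
  qed (use e \<eta>_pos ez in \<open>auto intro!: holomorphic_intros\<close>)
  moreover have "(\<lambda>t. f t / (exp (of_real \<eta> * t) - 1)) = reciprocity_fun"
    by (auto simp: f_def reciprocity_fun_def bernoulli_kernel_def fun_eq_iff sum_divide_distrib mult_ac)
  ultimately have "residue reciprocity_fun z = - 1 / z ^ (2 * m - 1) / of_real \<eta> * (1 / (cis (2 * pi * (of_int n * V\<alpha>)) - 1))"
    using tw by (simp add: f_def)
  also have "z ^ (2 * m - 1) * of_real \<eta> * of_real \<eta> ^ (2 * m - 2) = (of_real (2 * pi * of_int n) * \<i>) ^ (2 * m - 1)"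
  proof -
    have "of_real \<eta> * of_real \<eta> ^ (2 * m - 2) = (of_real \<eta> :: complex) ^ (2 * m - 1)"
      using m_ge by (simp add: numeral_2_eq_2 Suc_diff_Suc flip: power_Suc)
    moreover have "z * of_real \<eta> = of_real (2 * pi * of_int n) * \<i>"
      using \<eta>_pos by (simp add: z_def)
    ultimately show ?thesis by (metis mult.assoc power_mult_distrib)
  qed
  then have "- 1 / z ^ (2 * m - 1) / of_real \<eta> = - (of_real \<eta> ^ (2 * m - 2)) / (of_real (2 * pi * of_int n) * \<i>) ^ (2 * m - 1)"
    using \<eta>_pos n by (auto simp: field_simps z_def)
  finally show ?thesis unfolding z_def .
qed

section \<open>The contour integral\<close>

text \<open>
  On the circle \<open>|t| = r\<close> every point is at least as far from the pole \<open>2\<pi>in\<close> as \<open>r\<close> is from \<open>2\<pi>|n|\<close>, so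
  gaps on the positive real axis make both kernels bounded on the whole circle.
\<close>

lemma circle_integral_bound:
  assumes \<delta>: "\<delta> > 0" and r: "r > 0"
    and gap1: "\<And>n::int. \<delta> \<le> \<bar>r - 2 * pi * of_int n\<bar>"
    and gap2: "\<And>n::int. \<delta> \<le> \<bar>\<eta> * r - 2 * pi * of_int n\<bar>"
    and t: "norm t = r"
  shows "norm (reciprocity_fun t) \<le> of_int c * (1 + 1 / min (1/2) (\<delta>/2))\<^sup>2 / r ^ (2 * m - 1)"
proof -
  define C where "C = 1 + 1 / min (1/2) (\<delta>/2)"
  have "C > 0" using \<delta> by (auto simp: C_def add_pos_pos)
  have dist: "\<delta> \<le> norm (s - of_real (2 * pi * of_int n) * \<i>)"
    if "\<And>n::int. \<delta> \<le> \<bar>norm s - 2 * pi * of_int n\<bar>" for s and n :: int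
  proof -
    have "\<delta> \<le> \<bar>norm s - 2 * pi * of_int \<bar>n\<bar>\<bar>" by (rule that)
    also have "2 * pi * of_int \<bar>n\<bar> = norm (of_real (2 * pi * of_int n) * \<i>)"
      by (simp add: norm_mult)
    also have "\<bar>norm s - norm (of_real (2 * pi * of_int n) * \<i>)\<bar> \<le> norm (s - of_real (2 * pi * of_int n) * \<i>)"
      by (rule norm_triangle_ineq3)
    finally show ?thesis .
  qed
  have K1: "norm (bernoulli_kernel (x j) t) \<le> C" for j
    unfolding C_def by (intro norm_bernoulli_kernel_le \<delta> dist x_bounds) (use t gap1 in simp)
  have K2: "norm (bernoulli_kernel (y j) (of_real \<eta> * t)) \<le> C" for j
    unfolding C_def by (intro norm_bernoulli_kernel_le \<delta> dist y_bounds)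
      (use t gap2 \<eta>_pos in \<open>simp add: norm_mult\<close>)
  have "norm (\<Sum>j\<in>{0..<c}. bernoulli_kernel (x j) t * bernoulli_kernel (y j) (of_real \<eta> * t))
      \<le> of_nat (card {0..<c}) * (C * C)"
    by (rule sum_norm_bound) (use K1 K2 \<open>C > 0\<close> in \<open>auto simp: norm_mult intro!: mult_mono\<close>)
  also have "\<dots> = of_int c * C\<^sup>2" using c_pos by (simp add: power2_eq_square)
  finally show ?thesis
    unfolding reciprocity_fun_def norm_divide norm_power t C_def[symmetric]
    using r by (intro divide_right_mono) auto
qed

text \<open>
  This is the residue theorem on a circle that stays away from all poles. Up to the factor
  \<open>(-1)\<^sup>m (2\<pi>)\<^sup>1\<^sup>-\<^sup>2\<^sup>m\<close> the two finite cotangent sums are the residues at the nonzero poles inside, and the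
  integral over the circle is the error.
\<close>

lemma cot_dirichlet_reciprocity_at_gap:
  assumes \<delta>: "\<delta> > 0" and r: "r > 0"
    and gap1: "\<And>n::int. \<delta> \<le> \<bar>r - 2 * pi * of_int n\<bar>"
    and gap2: "\<And>n::int. \<delta> \<le> \<bar>\<eta> * r - 2 * pi * of_int n\<bar>"
  defines "N \<equiv> nat \<lfloor>r / (2 * pi)\<rfloor>" and "M \<equiv> nat \<lfloor>\<eta> * r / (2 * pi)\<rfloor>"
  shows "\<bar>cot_dirichlet N (2 * m - 1) \<alpha> - \<eta> ^ (2 * m - 2) * cot_dirichlet M (2 * m - 1) V\<alpha>
           - (- 1) ^ (m - 1) * (2 * pi) ^ (2 * m - 1) * bernoulli_sum\<bar>
       \<le> (2 * pi) ^ (2 * m - 1) * of_int c * (1 + 1 / min (1/2) (\<delta>/2))\<^sup>2 / r ^ (2 * m - 2)"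
proof -
  define X where "X = cot_dirichlet N (2 * m - 1) \<alpha> - \<eta> ^ (2 * m - 2) * cot_dirichlet M (2 * m - 1) V\<alpha>"
  define B where "B = of_int c * (1 + 1 / min (1/2) (\<delta>/2))\<^sup>2"
  define p where "p n = of_real (2 * pi * of_int n) * \<i>" for n :: int
  define q where "q n = of_real (2 * pi * (of_int n / \<eta>)) * \<i>" for n :: int
  define P where "P = p ` ({- int N..int N} - {0})"
  define Q where "Q = q ` ({- int M..int M} - {0})"
  define pts where "pts = insert 0 (P \<union> Q)"
  \<comment> \<open>By the gap hypotheses no pole has modulus between \<open>r\<close> and \<open>r + e\<close>, so the residue theorem applies
    in the disc of radius \<open>r + e\<close> with exactly the poles inside the circle.\<close>
  define e where "e = min \<delta> (\<delta> / \<eta>)"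
  have e: "e > 0" using \<delta> \<eta>_pos by (simp add: e_def)
  have norm_p: "norm (p n) = 2 * pi * \<bar>of_int n\<bar>" and norm_q: "norm (q n) = 2 * pi * \<bar>of_int n\<bar> / \<eta>" for n
    using \<eta>_pos by (simp_all add: p_def q_def norm_mult norm_divide)
  have mem_N: "n \<in> {- int N..int N} \<longleftrightarrow> norm (p n) \<le> r" for n
    unfolding N_def using r by (subst mem_symmetric_int_interval_iff) (auto simp: norm_p field_simps)
  have mem_M: "n \<in> {- int M..int M} \<longleftrightarrow> norm (q n) \<le> r" for n
    unfolding M_def using r \<eta>_pos by (subst mem_symmetric_int_interval_iff) (auto simp: norm_q field_simps)
  have inside_p: "norm (p n) < r" if "norm (p n) < r + e" for n
  proof -
    have "\<delta> \<le> \<bar>r - 2 * pi * of_int \<bar>n\<bar>\<bar>" by (rule gap1)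
    then show ?thesis using that \<delta> by (auto simp: norm_p e_def split: if_splits)
  qed
  have inside_q: "norm (q n) < r" if "norm (q n) < r + e" for n
  proof -
    have "2 * pi * \<bar>of_int n\<bar> / \<eta> < r + \<delta> / \<eta>" using that by (simp add: norm_q e_def)
    then have "2 * pi * \<bar>of_int n\<bar> < \<eta> * r + \<delta>" using \<eta>_pos by (simp add: field_simps)
    moreover have "\<delta> \<le> \<bar>\<eta> * r - 2 * pi * of_int \<bar>n\<bar>\<bar>" by (rule gap2)
    ultimately have "2 * pi * \<bar>of_int n\<bar> < \<eta> * r" using \<delta> by auto
    then show ?thesis using \<eta>_pos by (simp add: norm_q field_simps)
  qed
  have pts_inside: "norm z < r" if "z \<in> pts" for z
  proof -
    have "norm z \<le> r \<and> (z = 0 \<or> z \<in> range p \<or> z \<in> range q)"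
      using that r mem_N mem_M by (auto simp: pts_def P_def Q_def)
    then show ?thesis using inside_p inside_q r e by (auto simp: add_strict_increasing2 intro: le_less_trans)
  qed
  have fin: "finite pts" by (simp add: pts_def P_def Q_def)
  have holo: "reciprocity_fun holomorphic_on ball 0 (r + e) - pts"
  proof -
    have "exp t \<noteq> 1 \<and> exp (of_real \<eta> * t) \<noteq> 1 \<and> t \<noteq> 0" if t: "norm t < r + e" "t \<notin> pts" for t
    proof (intro conjI notI)
      assume "exp t = 1"
      then obtain n where n: "t = p n" unfolding exp_eq_1_iff_int p_def by blast
      with t inside_p[of n] mem_N[of n] show False by (cases "n = 0") (auto simp: pts_def P_def p_def)
    next
      assume "exp (of_real \<eta> * t) = 1"
      then obtain n :: int where "of_real \<eta> * t = of_real (2 * pi * of_int n) * \<i>" unfolding exp_eq_1_iff_int by blast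
      then have n: "t = q n" using \<eta>_pos by (simp add: q_def field_simps)
      with t inside_q[of n] mem_M[of n] show False by (cases "n = 0") (auto simp: pts_def Q_def q_def)
    qed (use t in \<open>simp add: pts_def\<close>)
    then show ?thesis
      unfolding reciprocity_fun_def bernoulli_kernel_def by (auto intro!: holomorphic_intros)
  qed
  have integral: "contour_integral (circlepath 0 r) reciprocity_fun
      = 2 * pi * \<i> * (\<Sum>z\<in>pts. winding_number (circlepath 0 r) z * residue reciprocity_fun z)"
  proof (rule Residue_theorem[OF _ _ fin holo])
    show "path_image (circlepath 0 r) \<subseteq> ball 0 (r + e) - pts"
      using r e by (auto simp: path_image_circlepath dest!: pts_inside)
    show "\<forall>z. z \<notin> ball 0 (r + e) \<longrightarrow> winding_number (circlepath 0 r) z = 0"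
    proof (intro allI impI)
      fix z :: complex assume z: "z \<notin> ball 0 (r + e)"
      show "winding_number (circlepath 0 r) z = 0"
        by (rule winding_number_zero_outside[of _ "cball 0 r"])
          (use z r e in \<open>auto simp: path_image_circlepath\<close>)
    qed
  qed auto
  also have "(\<Sum>z\<in>pts. winding_number (circlepath 0 r) z * residue reciprocity_fun z)
      = (\<Sum>z\<in>pts. residue reciprocity_fun z)"
    by (intro sum.cong refl) (simp add: winding_number_circlepath pts_inside)
  also have "\<dots> = of_real bernoulli_sum + ((\<Sum>z\<in>P. residue reciprocity_fun z) + (\<Sum>z\<in>Q. residue reciprocity_fun z))"
  proof -
    have disj: "P \<inter> Q = {}"
    proof -
      have False if n: "n \<noteq> 0" "p k = q n" for n k
      proof -
        have "2 * pi * of_int k = 2 * pi * (of_int n / \<eta>)"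
          using n(2) by (simp add: p_def q_def complex_eq_iff)
        then have "of_int k = of_int n / \<eta>" by (subst (asm) mult_left_cancel) auto
        with int_divide_eta_notin_Ints[OF n(1)] show False by (metis Ints_of_int)
      qed
      then show ?thesis by (auto simp: P_def Q_def)
    qed
    have "0 \<notin> P \<union> Q" using \<eta>_pos by (auto simp: P_def Q_def p_def q_def)
    with disj show ?thesis
      unfolding pts_def by (simp add: P_def Q_def sum.union_disjoint residue_at_0)
  qed
  also have "(\<Sum>z\<in>P. residue reciprocity_fun z) = of_real ((- 1) ^ m / (2 * pi) ^ (2 * m - 1) * cot_dirichlet N (2 * m - 1) \<alpha>)"
  proof -
    have "inj p" by (auto simp: inj_def p_def)
    then have "(\<Sum>z\<in>P. residue reciprocity_fun z) = (\<Sum>n\<in>{- int N..int N} - {0}. residue reciprocity_fun (p n))"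
      unfolding P_def by (subst sum.reindex) (auto intro: inj_on_subset)
    also have "\<dots> = (\<Sum>n\<in>{- int N..int N} - {0}.
      1 / (of_real (2 * pi * of_int n) * \<i>) ^ (2 * m - 1) * (1 / (cis (2 * pi * (of_int n * \<alpha>)) - 1)))"
      by (intro sum.cong refl) (simp only: p_def residue_at_int Diff_iff insert_iff not_False_eq_True de_Morgan_disj)
    finally show ?thesis unfolding sum_symmetric_residues_eq_cot_dirichlet[OF m_ge] .
  qed
  also have "(\<Sum>z\<in>Q. residue reciprocity_fun z)
      = - (of_real \<eta> ^ (2 * m - 2)) * of_real ((- 1) ^ m / (2 * pi) ^ (2 * m - 1) * cot_dirichlet M (2 * m - 1) V\<alpha>)"
  proof -
    have "inj q" using \<eta>_pos by (auto simp: inj_def q_def)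
    then have "(\<Sum>z\<in>Q. residue reciprocity_fun z) = (\<Sum>n\<in>{- int M..int M} - {0}. residue reciprocity_fun (q n))"
      unfolding Q_def by (subst sum.reindex) (auto intro: inj_on_subset)
    also have "\<dots> = (\<Sum>n\<in>{- int M..int M} - {0}. - (of_real \<eta> ^ (2 * m - 2)) *
      (1 / (of_real (2 * pi * of_int n) * \<i>) ^ (2 * m - 1) * (1 / (cis (2 * pi * (of_int n * V\<alpha>)) - 1))))"
      unfolding q_def
      by (intro sum.cong refl) (subst residue_at_int_divide_eta, auto)
    finally show ?thesis unfolding sum_distrib_left[symmetric] sum_symmetric_residues_eq_cot_dirichlet[OF m_ge] .
  qed
  also have "of_real bernoulli_sum + (of_real ((- 1) ^ m / (2 * pi) ^ (2 * m - 1) * cot_dirichlet N (2 * m - 1) \<alpha>)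
      + - (of_real \<eta> ^ (2 * m - 2)) * of_real ((- 1) ^ m / (2 * pi) ^ (2 * m - 1) * cot_dirichlet M (2 * m - 1) V\<alpha>))
    = complex_of_real (bernoulli_sum + (- 1) ^ m / (2 * pi) ^ (2 * m - 1) * X)"
    by (simp add: X_def algebra_simps diff_divide_distrib)
  finally have integral: "contour_integral (circlepath 0 r) reciprocity_fun
      = 2 * pi * \<i> * of_real (bernoulli_sum + (- 1) ^ m / (2 * pi) ^ (2 * m - 1) * X)" .
  have "continuous_on (path_image (circlepath 0 r)) reciprocity_fun"
    by (rule holomorphic_on_imp_continuous_on, rule holomorphic_on_subset[OF holo])
      (use r e in \<open>auto simp: path_image_circlepath dest!: pts_inside\<close>)
  then have "(reciprocity_fun has_contour_integral contour_integral (circlepath 0 r) reciprocity_fun) (circlepath 0 r)"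
    by (intro has_contour_integral_integral contour_integrable_continuous_circlepath)
  then have "norm (contour_integral (circlepath 0 r) reciprocity_fun) \<le> B / r ^ (2 * m - 1) * (2 * pi * r)"
    by (rule has_contour_integral_bound_circlepath)
      (use circle_integral_bound[OF \<delta> r gap1 gap2] r c_pos in \<open>auto simp: B_def\<close>)
  then have "\<bar>bernoulli_sum + (- 1) ^ m / (2 * pi) ^ (2 * m - 1) * X\<bar> * (2 * pi) \<le> (B / r ^ (2 * m - 1) * r) * (2 * pi)"
    unfolding integral norm_mult norm_of_real by (simp add: mult_ac)
  then have "\<bar>bernoulli_sum + (- 1) ^ m / (2 * pi) ^ (2 * m - 1) * X\<bar> \<le> B / r ^ (2 * m - 1) * r"
    by (rule mult_right_le_imp_le) simp
  also have "\<dots> = B / r ^ (2 * m - 2)"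
  proof -
    have "r ^ (2 * m - 1) = r ^ (2 * m - 2) * r"
      using m_ge by (simp add: numeral_2_eq_2 Suc_diff_Suc flip: power_Suc2)
    with r show ?thesis by simp
  qed
  finally have le: "\<bar>bernoulli_sum + (- 1) ^ m / (2 * pi) ^ (2 * m - 1) * X\<bar> \<le> B / r ^ (2 * m - 2)" .
  have sgn: "(- 1) ^ m = - ((- 1 :: real) ^ (m - 1))" "(- 1 :: real) ^ (m - 1) * (- 1) ^ (m - 1) = 1"
    using m_ge by (cases m; simp flip: power_mult_distrib)+
  have "X - (- 1) ^ (m - 1) * (2 * pi) ^ (2 * m - 1) * bernoulli_sum
      = (- 1) ^ m * (2 * pi) ^ (2 * m - 1) * (bernoulli_sum + (- 1) ^ m / (2 * pi) ^ (2 * m - 1) * X)"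
    using sgn by (simp add: algebra_simps)
  then have "\<bar>X - (- 1) ^ (m - 1) * (2 * pi) ^ (2 * m - 1) * bernoulli_sum\<bar>
      = (2 * pi) ^ (2 * m - 1) * \<bar>bernoulli_sum + (- 1) ^ m / (2 * pi) ^ (2 * m - 1) * X\<bar>"
    by (simp only: abs_mult power_abs) simp
  also have "\<dots> \<le> (2 * pi) ^ (2 * m - 1) * (B / r ^ (2 * m - 2))"
    using le by (intro mult_left_mono) auto
  finally show ?thesis by (simp add: X_def B_def mult_ac)
qed

end

section \<open>Estimates for the cotangent\<close>

text \<open>
  The cotangent of \<open>\<pi>u\<close> is a function of \<open>cis (2\<pi>u)\<close>, by \<open>odd_part_geometric_eq_cot\<close>.
\<close>

lemma cot_pi_int_shift:
  fixes u v :: real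
  assumes "u - v \<in> \<int>"
  shows "cot (pi * u) = cot (pi * v)"
proof -
  have c: "cis (2 * (pi * u)) = cis (2 * (pi * v))"
    using cis_eq_cis_int_shift[OF assms] by (simp only: mult.assoc)
  then have "cis (- (2 * (pi * u))) = cis (- (2 * (pi * v)))"
    by (metis cis_inverse)
  with c odd_part_geometric_eq_cot[of "pi * u"] odd_part_geometric_eq_cot[of "pi * v"]
  have "- \<i> * of_real (cot (pi * u)) = - \<i> * of_real (cot (pi * v))" by metis
  then show ?thesis by simp
qed

text \<open>
  The upper estimate of the cotangent is \<open>\<phi> \<le> tan \<phi>\<close>; the lower one is \<open>1/\<phi> \<le> 1/sin \<phi>\<close> together with
  \<open>1 \<le> sin \<phi> + cos \<phi>\<close>.
\<close>

lemma cot_near_inverse: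
  fixes \<phi> :: real
  assumes "0 < \<phi>" "\<phi> < pi / 2"
  shows "\<bar>cot \<phi> - 1 / \<phi>\<bar> \<le> 1"
proof -
  have s: "0 < sin \<phi>" and c: "0 < cos \<phi>"
    using assms by (auto intro!: sin_gt_zero cos_gt_zero)
  have "\<phi> \<le> tan \<phi>"
    using abs_tan_ge[of \<phi>] assms tan_gt_zero[of \<phi>] by simp
  then have "cot \<phi> \<le> 1 / \<phi>"
    using assms by (simp add: cot_altdef inverse_eq_divide frac_le)
  moreover have "1 / \<phi> \<le> 1 / sin \<phi>"
    using s assms sin_x_le_x[of \<phi>] by (simp add: frac_le)
  moreover have "1 / sin \<phi> \<le> 1 + cot \<phi>"
  proof -
    have "1\<^sup>2 \<le> (sin \<phi> + cos \<phi>)\<^sup>2"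
      using s c by (simp add: power2_sum)
    then have "1 \<le> sin \<phi> + cos \<phi>"
      by (rule power2_le_imp_le) (use s c in simp)
    then show ?thesis using s by (simp add: cot_def field_simps)
  qed
  ultimately show ?thesis by (simp add: abs_le_iff)
qed

lemma abs_cot_le_away_from_int:
  fixes \<theta> h :: real
  assumes "0 < h" "h \<le> \<theta>" "\<theta> \<le> 1 - h"
  shows "\<bar>cot (pi * \<theta>)\<bar> \<le> 1 / sin (pi * h)"
proof -
  have sh: "0 < sin (pi * h)"
    using assms by (intro sin_gt_zero) (auto simp: mult_less_cancel_left1)
  have half: "sin (pi * h) \<le> sin (pi * u)" if "h \<le> u" "u \<le> 1/2" for u
    using that assms by (intro sin_monotone_2pi_le) (auto simp: field_simps intro: order_trans[of _ 0])
  have "sin (pi * h) \<le> sin (pi * \<theta>)"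
  proof (cases "\<theta> \<le> 1/2")
    case False
    have "sin (pi * h) \<le> sin (pi * (1 - \<theta>))" using False assms by (intro half) auto
    also have "\<dots> = sin (pi * \<theta>)" by (simp add: right_diff_distrib)
    finally show ?thesis .
  qed (use assms half in auto)
  then have "\<bar>cot (pi * \<theta>)\<bar> = \<bar>cos (pi * \<theta>)\<bar> / sin (pi * \<theta>)"
    using sh by (simp add: cot_def abs_div)
  also have "\<dots> \<le> 1 / sin (pi * h)"
    using \<open>sin (pi * h) \<le> sin (pi * \<theta>)\<close> sh by (intro frac_le) auto
  finally show ?thesis .
qed

lemma gap_between_ints:
  fixes R g :: real
  assumes "of_int N + g \<le> R" "R \<le> of_int N + 1 - g" "0 < g"
  shows "\<lfloor>R\<rfloor> = N" and "g \<le> \<bar>R - of_int n\<bar>"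
proof -
  show "\<lfloor>R\<rfloor> = N" using assms by (simp add: floor_eq_iff)
  have "n \<le> N \<or> N + 1 \<le> n" by linarith
  then have "real_of_int n \<le> of_int N \<or> of_int N + 1 \<le> real_of_int n" by linarith
  then show "g \<le> \<bar>R - of_int n\<bar>" using assms by linarith
qed

lemma inverse_power_diff_le:
  fixes \<kappa> \<epsilon> :: real
  assumes "0 < \<kappa>" "0 \<le> \<epsilon>"
  shows "1 / \<kappa> ^ s - 1 / (\<kappa> + \<epsilon>) ^ s \<le> real s * \<epsilon> / \<kappa> ^ Suc s"
proof -
  define x where "x = - (\<epsilon> / (\<kappa> + \<epsilon>))"
  have "- 1 \<le> x" using assms by (simp add: x_def field_simps)
  then have "1 + real s * x \<le> (1 + x) ^ s" by (rule Bernoulli_inequality)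
  also have "1 + x = \<kappa> / (\<kappa> + \<epsilon>)" using assms by (simp add: x_def field_simps)
  finally have "1 - (\<kappa> / (\<kappa> + \<epsilon>)) ^ s \<le> real s * (\<epsilon> / (\<kappa> + \<epsilon>))" by (simp add: x_def)
  also have "\<dots> \<le> real s * (\<epsilon> / \<kappa>)"
    using assms by (intro mult_left_mono frac_le) auto
  finally have "(1 - (\<kappa> / (\<kappa> + \<epsilon>)) ^ s) / \<kappa> ^ s \<le> real s * (\<epsilon> / \<kappa>) / \<kappa> ^ s"
    using assms by (intro divide_right_mono) auto
  then show ?thesis using assms by (simp add: diff_divide_distrib power_divide mult_ac)
qed

section \<open>The circle next to the last pole and the correction term\<close>

context cot_reciprocity
begin

text \<open>
  The smaller of the spacings of the integers and of the multiples of \<open>1/\<eta>\<close>: an open interval of this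
  length contains at most one point of each kind.
\<close>

definition width :: real where "width = min 1 (1 / \<eta>)"

lemma width_bounds: "0 < width" "width \<le> 1" "\<eta> * width \<le> 1"
  using \<eta>_pos by (auto simp: width_def min_def field_simps)

text \<open>
  The circle of radius \<open>2\<pi>R\<close> has to enclose exactly the poles \<open>2\<pi>in/\<eta>\<close> with \<open>|n| \<le> k\<close>, that is
  \<open>k/\<eta> < R < (k + 1)/\<eta>\<close>, and to keep a distance from all poles that does not depend on \<open>k\<close>. Only the integer
  \<open>K + 1\<close> can be in the way. If it is far from \<open>k/\<eta>\<close>, the circle passes before it; otherwise it passes
  behind it, and the first sum acquires one extra term.
\<close>

lemma circle_estimate:
  obtains C where "C \<ge> 0" and
    "\<And>k N. k \<ge> 1 \<Longrightarrow>
      N = (let K = nat \<lfloor>real k / \<eta>\<rfloor> in if width / 2 \<le> real K + 1 - real k / \<eta> then K else Suc K) \<Longrightarrow>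
      \<bar>cot_dirichlet N (2 * m - 1) \<alpha> - \<eta> ^ (2 * m - 2) * cot_dirichlet k (2 * m - 1) V\<alpha>
           - (- 1) ^ (m - 1) * (2 * pi) ^ (2 * m - 1) * bernoulli_sum\<bar> \<le> C / real k ^ (2 * m - 2)"
proof -
  define g where "g = width / 4"
  have g: "0 < g" "g * 4 \<le> 1" "\<eta> * g * 4 \<le> 1"
    using width_bounds by (simp_all add: g_def)
  define \<delta> where "\<delta> = 2 * pi * min g (\<eta> * g)"
  have \<delta>: "\<delta> > 0" using g \<eta>_pos by (simp add: \<delta>_def)
  define A where "A = (2 * pi) ^ (2 * m - 1) * of_int c * (1 + 1 / min (1/2) (\<delta>/2))\<^sup>2"
  have A: "A \<ge> 0" using c_pos by (simp add: A_def)
  have "\<bar>cot_dirichlet N (2 * m - 1) \<alpha> - \<eta> ^ (2 * m - 2) * cot_dirichlet k (2 * m - 1) V\<alpha>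
           - (- 1) ^ (m - 1) * (2 * pi) ^ (2 * m - 1) * bernoulli_sum\<bar> \<le> A * \<eta> ^ (2 * m - 2) / real k ^ (2 * m - 2)"
    if k: "k \<ge> 1" and N: "N = (let K = nat \<lfloor>real k / \<eta>\<rfloor> in if width / 2 \<le> real K + 1 - real k / \<eta> then K else Suc K)"
    for k N
  proof -
    define \<kappa> where "\<kappa> = real k / \<eta>"
    have \<kappa>: "0 < \<kappa>" "\<eta> * \<kappa> = real k" using k \<eta>_pos by (simp_all add: \<kappa>_def)
    define K where "K = nat \<lfloor>\<kappa>\<rfloor>"
    have K: "real K \<le> \<kappa>" "\<kappa> < real K + 1" using \<kappa> by (simp_all add: K_def)
    have N': "N = (if 2 * g \<le> real K + 1 - \<kappa> then K else Suc K)"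
      using N by (simp add: K_def \<kappa>_def g_def Let_def)
    define R where "R = \<kappa> + (if 2 * g \<le> real K + 1 - \<kappa> then g else 3 * g)"
    have R: "0 < R" "\<kappa> \<le> R" using \<kappa> g by (auto simp: R_def)
    have Nbounds: "of_int (int N) + g \<le> R" "R \<le> of_int (int N) + 1 - g"
      using K g by (auto simp: N' R_def split: if_splits)
    have "\<eta> * g \<le> \<eta> * (R - \<kappa>)" "\<eta> * (R - \<kappa>) \<le> \<eta> * (3 * g)"
      using g \<eta>_pos by (auto simp: R_def intro!: mult_left_mono)
    then have kbounds: "of_int (int k) + \<eta> * g \<le> \<eta> * R" "\<eta> * R \<le> of_int (int k) + 1 - \<eta> * g"
      using \<kappa>(2) g(3) by (simp_all add: right_diff_distrib)
    have \<eta>g: "0 < \<eta> * g" using \<eta>_pos g by simp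
    define r where "r = 2 * pi * R"
    have r: "r > 0" using R by (simp add: r_def)
    have floors: "nat \<lfloor>r / (2 * pi)\<rfloor> = N" "nat \<lfloor>\<eta> * r / (2 * pi)\<rfloor> = k"
      using gap_between_ints(1)[OF Nbounds g(1)] gap_between_ints(1)[OF kbounds \<eta>g]
      by (simp_all add: r_def mult.left_commute)
    have gap1: "\<delta> \<le> \<bar>r - 2 * pi * of_int n\<bar>" for n
    proof -
      have "2 * pi * min g (\<eta> * g) \<le> 2 * pi * \<bar>R - of_int n\<bar>"
        using gap_between_ints(2)[OF Nbounds g(1), of n] by (intro mult_left_mono) auto
      also have "\<dots> = \<bar>r - 2 * pi * of_int n\<bar>"
        by (simp add: r_def abs_mult flip: right_diff_distrib)
      finally show ?thesis by (simp add: \<delta>_def)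
    qed
    have gap2: "\<delta> \<le> \<bar>\<eta> * r - 2 * pi * of_int n\<bar>" for n
    proof -
      have "2 * pi * min g (\<eta> * g) \<le> 2 * pi * \<bar>\<eta> * R - of_int n\<bar>"
        using gap_between_ints(2)[OF kbounds \<eta>g, of n] by (intro mult_left_mono) auto
      also have "\<dots> = \<bar>2 * pi * (\<eta> * R - of_int n)\<bar>" by (simp add: abs_mult)
      also have "2 * pi * (\<eta> * R - of_int n) = \<eta> * r - 2 * pi * of_int n"
        by (simp add: r_def algebra_simps)
      finally show ?thesis by (simp add: \<delta>_def)
    qed
    have "\<bar>cot_dirichlet N (2 * m - 1) \<alpha> - \<eta> ^ (2 * m - 2) * cot_dirichlet k (2 * m - 1) V\<alpha>
           - (- 1) ^ (m - 1) * (2 * pi) ^ (2 * m - 1) * bernoulli_sum\<bar> \<le> A / r ^ (2 * m - 2)"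
      using cot_dirichlet_reciprocity_at_gap[OF \<delta> r gap1 gap2] unfolding floors A_def .
    also have "\<dots> \<le> A / \<kappa> ^ (2 * m - 2)"
    proof -
      have "\<kappa> \<le> R" by (rule R)
      also have "1 * R \<le> r" unfolding r_def using R pi_ge_two by (intro mult_right_mono) auto
      finally show ?thesis using A \<kappa>(1) r by (intro divide_left_mono power_mono) auto
    qed
    also have "\<dots> = A * \<eta> ^ (2 * m - 2) / real k ^ (2 * m - 2)"
      using k \<eta>_pos by (simp add: \<kappa>_def power_divide)
    finally show ?thesis .
  qed
  then show thesis using that[of "A * \<eta> ^ (2 * m - 2)"] A \<eta>_pos by auto
qed

definition correction :: "nat \<Rightarrow> nat \<Rightarrow> real" where
  "correction K k = \<eta> ^ (2 * m - 2) / (pi * real k ^ (2 * m - 1))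
            * (1 / (1 - frac (of_int (int K - a * int k) / of_int c)
                      - inverse (of_int c) * frac (real k / \<eta>)))"

lemma abs_correction_le:
  assumes "k \<ge> 1" "0 < u"
    and "u \<le> 1 - frac (of_int (int K - a * int k) / of_int c) - inverse (of_int c) * frac (real k / \<eta>)"
  shows "\<bar>correction K k\<bar> \<le> \<eta> ^ (2 * m - 2) / (pi * u) / real k ^ (2 * m - 1)"
proof -
  define v where "v = 1 - frac (of_int (int K - a * int k) / of_int c) - inverse (of_int c) * frac (real k / \<eta>)"
  have v: "0 < v" "u \<le> v" using assms by (simp_all add: v_def)
  have "\<bar>correction K k\<bar> = \<eta> ^ (2 * m - 2) / (pi * real k ^ (2 * m - 1)) * (1 / v)"
    unfolding correction_def v_def[symmetric] using v \<eta>_pos by simp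
  also have "\<dots> \<le> \<eta> ^ (2 * m - 2) / (pi * real k ^ (2 * m - 1)) * (1 / u)"
    using v assms(2) \<eta>_pos by (intro mult_left_mono frac_le) auto
  finally show ?thesis by (simp add: mult_ac)
qed

text \<open>
  As the residue of \<open>K - ak\<close> modulo \<open>c\<close> is at most \<open>c - 1\<close>, the denominator of the correction term is at
  least \<open>(K + 1 - k/\<eta>)/c\<close>.
\<close>

lemma correction_small:
  assumes k: "k \<ge> 1" and K: "K = nat \<lfloor>real k / \<eta>\<rfloor>"
    and far: "width / 2 \<le> real K + 1 - real k / \<eta>"
  shows "\<bar>correction K k\<bar> \<le> \<eta> ^ (2 * m - 2) / (pi * (width / (2 * of_int c))) / real k ^ (2 * m - 1)"
proof (rule abs_correction_le[OF k])
  show "0 < width / (2 * of_int c)" using width_bounds c_pos by simp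
  have "frac (of_int (int K - a * int k) / of_int c :: real) \<le> (of_int c - 1) / of_int c"
  proof -
    have "(int K - a * int k) mod c \<le> c - 1" using pos_mod_bound[OF c_pos, of "int K - a * int k"] by linarith
    then show ?thesis unfolding frac_of_int_divide[OF c_pos] using c_pos
      by (intro divide_right_mono) linarith+
  qed
  moreover have "frac (real k / \<eta>) = real k / \<eta> - real K"
    using K \<eta>_pos by (simp add: frac_def)
  then have "inverse (of_int c) * frac (real k / \<eta>) \<le> inverse (of_int c) * (1 - width / 2)"
    using far c_pos by (intro mult_left_mono) auto
  ultimately show "width / (2 * of_int c) \<le> 1 - frac (of_int (int K - a * int k) / of_int c)
      - inverse (of_int c) * frac (real k / \<eta>)"
    using c_pos by (simp add: field_simps)
qed

text \<open>
  Let \<open>n = K + 1\<close> and \<open>\<epsilon> = n - k/\<eta>\<close>, which may be arbitrarily small. Modulo integers \<open>n\<alpha>\<close> is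
  \<open>(\<eta>\<epsilon> + i)/c\<close>, where \<open>i\<close> is the residue of \<open>k - dn\<close> modulo \<open>c\<close>. If \<open>i \<noteq> 0\<close>, both the cotangent and the
  correction factor are bounded. If \<open>i = 0\<close>, the cotangent is \<open>c/(\<pi>\<eta>\<epsilon>)\<close> up to a bounded error and the
  denominator of the correction term is \<open>\<epsilon>/c\<close>. The two terms then differ by \<open>c/(\<pi>\<eta>\<epsilon>)\<close> times the
  difference of \<open>(k/\<eta>)\<^sup>-\<^sup>s\<close> and \<open>n\<^sup>-\<^sup>s\<close>, where \<open>s = 2m - 1\<close>; that difference is \<open>O(\<epsilon> k\<^sup>-\<^sup>s)\<close>, so \<open>\<epsilon>\<close>
  cancels.
\<close>

lemma correction_cancels_cot:
  obtains C where "C \<ge> 0" and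
    "\<And>k K. k \<ge> 1 \<Longrightarrow> K = nat \<lfloor>real k / \<eta>\<rfloor> \<Longrightarrow> real K + 1 - real k / \<eta> < width / 2 \<Longrightarrow>
      \<bar>correction K k - cot (pi * real (Suc K) * \<alpha>) / real (Suc K) ^ (2 * m - 1)\<bar> \<le> C / real k ^ (2 * m - 1)"
proof -
  define s where "s = 2 * m - 1"
  have \<eta>s: "\<eta> ^ s = \<eta> ^ (2 * m - 2) * \<eta>"
    using m_ge by (simp add: s_def numeral_2_eq_2 Suc_diff_Suc flip: power_Suc2)
  \<comment> \<open>\<open>\<eta>\<epsilon> < 1/2\<close> keeps \<open>(\<eta>\<epsilon> + i)/c\<close> with \<open>0 < i < c\<close> at distance \<open>1/(2c)\<close> from the integers.\<close>
  define h where "h = 1 / (2 * real_of_int c)"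
  have sh: "0 < sin (pi * h)"
    using c_pos by (intro sin_gt_zero) (auto simp: h_def field_simps)
  define C1 where "C1 = of_int c * real s / (pi * \<eta>) * \<eta> ^ Suc s + \<eta> ^ s"
  define C2 where "C2 = \<eta> ^ (2 * m - 2) / (pi * (1 / of_int c)) + \<eta> ^ s / sin (pi * h)"
  have C: "0 \<le> C1" "0 \<le> C2"
    using c_pos \<eta>_pos sh by (simp_all add: C1_def C2_def)
  have "\<bar>correction K k - cot (pi * real (Suc K) * \<alpha>) / real (Suc K) ^ s\<bar> \<le> (C1 + C2) / real k ^ s"
    if k: "k \<ge> 1" and K: "K = nat \<lfloor>real k / \<eta>\<rfloor>" and near: "real K + 1 - real k / \<eta> < width / 2" for k K
  proof -
    define n where "n = Suc K"
    define \<kappa> where "\<kappa> = real k / \<eta>"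
    define \<epsilon> where "\<epsilon> = real n - \<kappa>"
    have \<kappa>: "0 < \<kappa>" using k \<eta>_pos by (simp add: \<kappa>_def)
    have \<kappa>s: "1 / \<kappa> ^ j = \<eta> ^ j / real k ^ j" for j by (simp add: \<kappa>_def power_divide)
    have n: "real n = \<kappa> + \<epsilon>" by (simp add: \<epsilon>_def)
    have fl: "\<lfloor>\<kappa>\<rfloor> = int K" using K \<kappa> by (simp add: \<kappa>_def)
    then have frac\<kappa>: "frac (real k / \<eta>) = 1 - \<epsilon>"
      unfolding frac_def \<kappa>_def[symmetric] by (simp add: \<epsilon>_def n_def)
    have \<epsilon>: "0 < \<epsilon>" "\<epsilon> < width / 2"
      using near fl by (auto simp: \<kappa>_def \<epsilon>_def n_def floor_eq_iff)
    have \<eta>\<epsilon>: "0 < \<eta> * \<epsilon>" "\<eta> * \<epsilon> < 1/2"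
    proof -
      have "\<eta> * \<epsilon> < \<eta> * (width / 2)" using \<epsilon> \<eta>_pos by (intro mult_strict_left_mono) auto
      then show "\<eta> * \<epsilon> < 1/2" using width_bounds(3) by linarith
    qed (use \<epsilon> \<eta>_pos in simp)
    have n_pow: "1 / real n ^ s \<le> \<eta> ^ s / real k ^ s"
      unfolding \<kappa>s[symmetric] n using \<kappa> \<epsilon> by (intro divide_left_mono power_mono) auto
    have n\<alpha>: "real n * \<alpha> = (\<eta> * \<epsilon> + of_int (int k - d * int n)) / of_int c"
    proof -
      have "\<eta> * \<epsilon> = \<eta> * real n - real k" using \<eta>_pos by (simp add: \<epsilon>_def \<kappa>_def field_simps)
      then show ?thesis using c_pos by (simp add: \<eta>_eq field_simps)
    qed
    define i where "i = (int k - d * int n) mod c"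
    have i: "0 \<le> i" "i \<le> c - 1"
      using pos_mod_bound[OF c_pos, of "int k - d * int n"] c_pos by (simp_all add: i_def)
    have cot_n: "cot (pi * real n * \<alpha>) = cot (pi * ((\<eta> * \<epsilon> + of_int i) / of_int c))"
    proof -
      have "real_of_int (int k - d * int n) = of_int ((int k - d * int n) div c) * of_int c + of_int i"
        unfolding i_def by (metis div_mult_mod_eq of_int_add of_int_mult)
      then have "real n * \<alpha> - (\<eta> * \<epsilon> + of_int i) / of_int c = of_int ((int k - d * int n) div c)"
        unfolding n\<alpha> using c_pos by (simp add: field_simps)
      then have "cot (pi * (real n * \<alpha>)) = cot (pi * ((\<eta> * \<epsilon> + of_int i) / of_int c))"
        by (intro cot_pi_int_shift) simp
      then show ?thesis by (simp only: mult.assoc)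
    qed
    define l where "l = (int K - a * int k) mod c"
    have l: "0 \<le> l" "l \<le> c - 1"
      using pos_mod_bound[OF c_pos, of "int K - a * int k"] c_pos by (simp_all add: l_def)
    define u where "u = 1 - frac (of_int (int K - a * int k) / of_int c) - inverse (of_int c) * frac (real k / \<eta>)"
    have u: "u = (of_int (c - 1 - l) + \<epsilon>) / of_int c"
      unfolding u_def frac_of_int_divide[OF c_pos] frac\<kappa> l_def[symmetric] using c_pos by (simp add: field_simps)
    \<comment> \<open>The correction term and the cotangent become singular for the same \<open>k\<close>: since \<open>ad \<equiv> 1\<close> modulo \<open>c\<close>,
      \<open>n \<equiv> ak\<close> is equivalent to \<open>k \<equiv> dn\<close>.\<close>
    have lattice: "l = c - 1 \<longleftrightarrow> i = 0"
    proof -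
      have "l = c - 1 \<longleftrightarrow> c dvd int n - a * int k"
      proof -
        have "(int n - a * int k) mod c = (l + 1) mod c" by (simp add: l_def n_def mod_add_right_eq algebra_simps mod_add_left_eq)
        then have "c dvd int n - a * int k \<longleftrightarrow> c dvd l + 1" by (simp add: dvd_eq_mod_eq_0)
        also have "\<dots> \<longleftrightarrow> l = c - 1" using l zdvd_imp_le[of c "l + 1"] by auto
        finally show ?thesis by simp
      qed
      also have "\<dots> \<longleftrightarrow> c dvd int k - d * int n"
      proof
        assume "c dvd int n - a * int k"
        then have "c dvd - d * (int n - a * int k) - c * (b * int k)" by (rule dvd_diff[OF dvd_mult dvd_triv_left])
        also have "- d * (int n - a * int k) - c * (b * int k) = int k - d * int n" using det by algebra
        finally show "c dvd int k - d * int n" .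
      next
        assume "c dvd int k - d * int n"
        then have "c dvd - a * (int k - d * int n) - c * (b * int n)" by (rule dvd_diff[OF dvd_mult dvd_triv_left])
        also have "- a * (int k - d * int n) - c * (b * int n) = int n - a * int k" using det by algebra
        finally show "c dvd int n - a * int k" .
      qed
      also have "\<dots> \<longleftrightarrow> i = 0" by (simp add: i_def dvd_eq_mod_eq_0)
      finally show ?thesis .
    qed
    show ?thesis
    proof (cases "i = 0")
      case True
      define \<phi> where "\<phi> = pi * (\<eta> * \<epsilon> / of_int c)"
      have \<phi>: "0 < \<phi>" "\<phi> < pi / 2"
      proof -
        have "\<eta> * \<epsilon> / of_int c \<le> \<eta> * \<epsilon> / 1" using \<eta>\<epsilon> c_pos by (intro divide_left_mono) auto
        then have "\<eta> * \<epsilon> / of_int c < 1/2" using \<eta>\<epsilon>(2) by (simp only: div_by_1)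
        then have "\<phi> < pi * (1/2)" unfolding \<phi>_def by (rule mult_strict_left_mono) simp
        then show "\<phi> < pi / 2" by simp
      qed (use \<eta>\<epsilon> c_pos in \<open>simp add: \<phi>_def\<close>)
      have "u = \<epsilon> / of_int c" using True lattice by (simp add: u)
      then have corr: "correction K k = \<eta> ^ (2 * m - 2) / (pi * real k ^ s) * (of_int c / \<epsilon>)"
        unfolding correction_def u_def[symmetric] by (simp add: s_def)
      have main: "correction K k - 1 / \<phi> / real n ^ s = of_int c / (pi * \<eta> * \<epsilon>) * (1 / \<kappa> ^ s - 1 / real n ^ s)"
        unfolding corr \<kappa>s \<eta>s \<phi>_def using \<eta>_pos by (simp add: right_diff_distrib mult_ac)
      have "0 \<le> 1 / \<kappa> ^ s - 1 / real n ^ s" using n_pow by (simp add: \<kappa>s)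
      then have "\<bar>correction K k - 1 / \<phi> / real n ^ s\<bar>
          = of_int c / (pi * \<eta> * \<epsilon>) * (1 / \<kappa> ^ s - 1 / real n ^ s)"
        unfolding main using c_pos \<eta>_pos \<epsilon> by (simp add: abs_mult)
      also have "\<dots> \<le> of_int c / (pi * \<eta> * \<epsilon>) * (real s * \<epsilon> / \<kappa> ^ Suc s)"
        unfolding n using inverse_power_diff_le[of \<kappa> \<epsilon> s] \<kappa> \<epsilon> c_pos \<eta>_pos by (intro mult_left_mono) auto
      also have "\<dots> = of_int c * real s / (pi * \<eta>) * (1 / \<kappa> ^ Suc s)"
        using \<epsilon> by (simp add: field_simps)
      also have "\<dots> \<le> of_int c * real s / (pi * \<eta>) * (\<eta> ^ Suc s / real k ^ s)"
      proof -
        have "1 / \<kappa> ^ Suc s \<le> \<eta> ^ Suc s / real k ^ s"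
          unfolding \<kappa>s using k \<eta>_pos by (intro divide_left_mono power_increasing) auto
        then show ?thesis using c_pos \<eta>_pos by (intro mult_left_mono) auto
      qed
      finally have e1: "\<bar>correction K k - 1 / \<phi> / real n ^ s\<bar>
          \<le> of_int c * real s / (pi * \<eta>) * \<eta> ^ Suc s / real k ^ s" by simp
      have "\<bar>1 / \<phi> / real n ^ s - cot \<phi> / real n ^ s\<bar> = \<bar>cot \<phi> - 1 / \<phi>\<bar> * (1 / real n ^ s)"
        unfolding diff_divide_distrib[symmetric] abs_divide by (simp add: abs_minus_commute)
      also have "\<dots> \<le> 1 * (\<eta> ^ s / real k ^ s)"
        using cot_near_inverse[OF \<phi>] n_pow by (intro mult_mono) auto
      finally have "\<bar>correction K k - cot \<phi> / real n ^ s\<bar> \<le> C1 / real k ^ s"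
        using e1 unfolding C1_def add_divide_distrib by linarith
      moreover have "cot (pi * real n * \<alpha>) = cot \<phi>" by (simp add: cot_n True \<phi>_def)
      ultimately have "\<bar>correction K k - cot (pi * real n * \<alpha>) / real n ^ s\<bar> \<le> C1 / real k ^ s" by simp
      also have "\<dots> \<le> (C1 + C2) / real k ^ s" using C by (intro divide_right_mono) auto
      finally show ?thesis by (simp add: n_def)
    next
      case False
      have "1 \<le> c - 1 - l" using False lattice l by auto
      then have "1 \<le> real_of_int (c - 1 - l)" by linarith
      then have "1 / of_int c \<le> u" unfolding u using c_pos \<epsilon> by (intro divide_right_mono) auto
      then have e1: "\<bar>correction K k\<bar> \<le> \<eta> ^ (2 * m - 2) / (pi * (1 / of_int c)) / real k ^ s"
        unfolding s_def u_def using c_pos by (intro abs_correction_le k) auto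
      have i1: "1 \<le> real_of_int i" "real_of_int i \<le> of_int c - 1" using False i by linarith+
      have "\<bar>cot (pi * real n * \<alpha>)\<bar> \<le> 1 / sin (pi * h)"
        unfolding cot_n
      proof (rule abs_cot_le_away_from_int)
        have h: "h = (1/2) / of_int c" "1 - h = (of_int c - 1/2) / of_int c"
          using c_pos by (simp_all add: h_def field_simps)
        show "h \<le> (\<eta> * \<epsilon> + of_int i) / of_int c"
          unfolding h(1) by (rule divide_right_mono) (use i1 \<eta>\<epsilon> c_pos in auto)
        show "(\<eta> * \<epsilon> + of_int i) / of_int c \<le> 1 - h"
          unfolding h(2) by (rule divide_right_mono) (use i1 \<eta>\<epsilon> c_pos in auto)
      qed (use c_pos in \<open>simp add: h_def\<close>)
      then have "\<bar>cot (pi * real n * \<alpha>)\<bar> * (1 / real n ^ s) \<le> 1 / sin (pi * h) * (\<eta> ^ s / real k ^ s)"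
        using n_pow sh by (intro mult_mono) auto
      then have "\<bar>cot (pi * real n * \<alpha>) / real n ^ s\<bar> \<le> \<eta> ^ s / sin (pi * h) / real k ^ s"
        by (simp add: abs_div)
      with e1 have "\<bar>correction K k - cot (pi * real n * \<alpha>) / real n ^ s\<bar> \<le> C2 / real k ^ s"
        unfolding C2_def add_divide_distrib by linarith
      also have "\<dots> \<le> (C1 + C2) / real k ^ s" using C by (intro divide_right_mono) auto
      finally show ?thesis by (simp add: n_def)
    qed
  qed
  then show thesis using that[of "C1 + C2"] C by (auto simp: s_def)
qed

lemma cot_dirichlet_reciprocity:
  assumes "m \<ge> 2"
  shows "(\<lambda>k. cot_dirichlet (nat \<lfloor>real k / \<eta>\<rfloor>) (2 * m - 1) \<alpha>
      - \<eta> ^ (2 * m - 2) * cot_dirichlet k (2 * m - 1) V\<alpha> + correction (nat \<lfloor>real k / \<eta>\<rfloor>) k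
      - (- 1) ^ (m - 1) * (2 * pi) ^ (2 * m - 1) * bernoulli_sum) \<in> O(\<lambda>k. 1 / real k)"
proof -
  obtain C0 where C0: "C0 \<ge> 0" and
    est: "\<And>k N. k \<ge> 1 \<Longrightarrow>
      N = (let K = nat \<lfloor>real k / \<eta>\<rfloor> in if width / 2 \<le> real K + 1 - real k / \<eta> then K else Suc K) \<Longrightarrow>
      \<bar>cot_dirichlet N (2 * m - 1) \<alpha> - \<eta> ^ (2 * m - 2) * cot_dirichlet k (2 * m - 1) V\<alpha>
           - (- 1) ^ (m - 1) * (2 * pi) ^ (2 * m - 1) * bernoulli_sum\<bar> \<le> C0 / real k ^ (2 * m - 2)"
    using circle_estimate by blast
  obtain C1 where C1: "C1 \<ge> 0" and
    cancel: "\<And>k K. k \<ge> 1 \<Longrightarrow> K = nat \<lfloor>real k / \<eta>\<rfloor> \<Longrightarrow> real K + 1 - real k / \<eta> < width / 2 \<Longrightarrow>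
      \<bar>correction K k - cot (pi * real (Suc K) * \<alpha>) / real (Suc K) ^ (2 * m - 1)\<bar> \<le> C1 / real k ^ (2 * m - 1)"
    using correction_cancels_cot by blast
  define C2 where "C2 = \<eta> ^ (2 * m - 2) / (pi * (width / (2 * of_int c)))"
  have C2: "C2 \<ge> 0" using \<eta>_pos width_bounds c_pos by (simp add: C2_def)
  have le: "C / real k ^ p \<le> C * (1 / real k)" if "C \<ge> 0" "k \<ge> 1" "p \<ge> 1" for C k p
  proof -
    have "real k ^ 1 \<le> real k ^ p" using that by (intro power_increasing) auto
    then show ?thesis using that by (simp add: frac_le)
  qed
  have p1: "1 \<le> 2 * m - 1" using assms by simp
  show ?thesis
  proof (intro bigoI[where c = "C0 + C1 + C2"] eventually_mono[OF eventually_ge_at_top[of 1]])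
    fix k :: nat assume k: "k \<ge> 1"
    define K where "K = nat \<lfloor>real k / \<eta>\<rfloor>"
    define E where "E N = cot_dirichlet N (2 * m - 1) \<alpha> - \<eta> ^ (2 * m - 2) * cot_dirichlet k (2 * m - 1) V\<alpha>
           - (- 1) ^ (m - 1) * (2 * pi) ^ (2 * m - 1) * bernoulli_sum" for N
    have E: "\<bar>E (if width / 2 \<le> real K + 1 - real k / \<eta> then K else Suc K)\<bar> \<le> C0 * (1 / real k)"
    proof -
      have "\<bar>E (if width / 2 \<le> real K + 1 - real k / \<eta> then K else Suc K)\<bar> \<le> C0 / real k ^ (2 * m - 2)"
        using est[OF k refl] unfolding E_def K_def Let_def .
      also have "\<dots> \<le> C0 * (1 / real k)" using assms by (intro le C0 k) simp
      finally show ?thesis .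
    qed
    have "\<bar>E K + correction K k\<bar> \<le> C0 * (1 / real k) + C1 * (1 / real k) + C2 * (1 / real k)"
    proof (cases "width / 2 \<le> real K + 1 - real k / \<eta>")
      case True
      have "\<bar>correction K k\<bar> \<le> C2 * (1 / real k)"
        using correction_small[OF k K_def True] le[OF C2 k p1] by (simp add: C2_def)
      moreover have "\<bar>E K\<bar> \<le> C0 * (1 / real k)" using E True by simp
      moreover have "0 \<le> C1 * (1 / real k)" using C1 by simp
      ultimately show ?thesis by linarith
    next
      case False
      have "E (Suc K) = E K + cot (pi * real (Suc K) * \<alpha>) / real (Suc K) ^ (2 * m - 1)"
        by (simp add: E_def cot_dirichlet_def)
      moreover have "\<bar>correction K k - cot (pi * real (Suc K) * \<alpha>) / real (Suc K) ^ (2 * m - 1)\<bar> \<le> C1 * (1 / real k)"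
        using cancel[OF k K_def] False le[OF C1 k p1] by simp
      moreover have "\<bar>E (Suc K)\<bar> \<le> C0 * (1 / real k)" using E False by simp
      moreover have "0 \<le> C2 * (1 / real k)" using C2 by simp
      ultimately show ?thesis by linarith
    qed
    then show "norm (cot_dirichlet (nat \<lfloor>real k / \<eta>\<rfloor>) (2 * m - 1) \<alpha>
      - \<eta> ^ (2 * m - 2) * cot_dirichlet k (2 * m - 1) V\<alpha> + correction (nat \<lfloor>real k / \<eta>\<rfloor>) k
      - (- 1) ^ (m - 1) * (2 * pi) ^ (2 * m - 1) * bernoulli_sum) \<le> (C0 + C1 + C2) * norm (1 / real k)"
      unfolding E_def K_def by (simp add: algebra_simps add_divide_distrib)
  qed
qed

end

theorem theorem1p1:
  fixes \<alpha> \<eta> V\<alpha> :: real and a b c d :: int and m :: nat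
    and K :: "nat \<Rightarrow> nat" and x y :: "int \<Rightarrow> real"
  assumes "\<alpha> \<notin> \<rat>"
    and "a * d - b * c = 1" and "c > 0"
    and "V\<alpha> = (of_int a * \<alpha> + of_int b) / (of_int c * \<alpha> + of_int d)"
    and "\<eta> = of_int c * \<alpha> + of_int d" and "\<eta> > 0"
    and "m \<ge> 2"
    and "\<And>k. K k = nat \<lfloor>real k / \<eta>\<rfloor>"
    and "\<And>j. x j = 1 - frac (of_int (d * j) / of_int c)"
    and "\<And>j. y j = frac (of_int j / of_int c)"
  shows "(\<lambda>k::nat.
      (cot_dirichlet (K k) (2 * m - 1) \<alpha>
        - \<eta> ^ (2 * m - 2) * cot_dirichlet k (2 * m - 1) V\<alpha>
        + \<eta> ^ (2 * m - 2) / (pi * real k ^ (2 * m - 1))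
            * (1 / (1 - frac (of_int (int (K k) - a * int k) / of_int c)
                      - inverse (of_int c) * frac (real k / \<eta>))))
      - (- 1) ^ (m - 1) * (2 * pi) ^ (2 * m - 1)
        * (\<Sum>l=0..2*m. \<Sum>j\<in>{0..<c}.
              bernoulli_poly l (x j) * bernoulli_poly (2 * m - l) (y j)
                / (fact l * fact (2 * m - l))
              * \<eta> powi (2 * int m - int l - 1)))
    \<in> O[sequentially](\<lambda>k. 1 / real k)"
proof -
  interpret cot_reciprocity \<alpha> \<eta> V\<alpha> a b c d m x y
    using assms by unfold_locales auto
  show ?thesis
    using cot_dirichlet_reciprocity[OF assms(7)]
    unfolding assms(8) correction_def bernoulli_sum_def .
qed

end
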